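(* Every randomized semi-online algorithm for weighted caching with cache size $k$ has competitive ratio $\Omega(\log k)$. That is, the competitive ratio of any algorithm for weighted caching, even if provided at each time with exact (error-free) predictions of the time of the next request to each page, is $\Omega(\log k)$.
   Context: Weighted caching: a cache holds $k$ pages, each page $p$ has a weight $w_p>0$. Requests to pages arrive online; if the requested page is not in the cache it must be loaded (evicting another page if the cache is full), and each time a page enters the cache its weight is paid. The goal is to minimize total cost. An algorithm is semi-online if it is online except that in each round it receives as additional input the exact time of the next request to each page. The competitive ratio is measured against the optimal offline cost (expected cost at most ratio times optimum plus an additive constant). *)

theory Defs
  imports "HOL-Probability.Probability"
begin

type_synonym page = nat
type_synonym cache = "page set"

definition weighted_instance :: "page set \<Rightarrow> (page \<Rightarrow> real) \<Rightarrow> bool" where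
  "weighted_instance U w \<longleftrightarrow> finite U \<and> (\<forall>p\<in>U. w p > 0)"

definition serves :: "page set \<Rightarrow> nat \<Rightarrow> page \<Rightarrow> cache \<Rightarrow> bool" where
  "serves U k r C \<longleftrightarrow> C \<subseteq> U \<and> card C \<le> k \<and> r \<in> C"

text \<open>
  The cost of moving through a list of cache contents, where the first argument of
  \<open>cost_from\<close> after the weights is the content before the first move.
  Several pages may enter the cache in a single round, for the algorithm as well as for
  the offline optimum; postponing loads until they are needed shows that this does not
  change the achievable costs.
\<close>

primrec cost_from :: "(page \<Rightarrow> real) \<Rightarrow> cache \<Rightarrow> cache list \<Rightarrow> real" where
  "cost_from w C [] = 0"
| "cost_from w C (D # Ds) = (\<Sum>p\<in>D - C. w p) + cost_from w D Ds"

definition cost :: "(page \<Rightarrow> real) \<Rightarrow> cache list \<Rightarrow> real" where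
  "cost w Cs = cost_from w {} Cs"

definition opt :: "page set \<Rightarrow> nat \<Rightarrow> (page \<Rightarrow> real) \<Rightarrow> page list \<Rightarrow> real" where
  "opt U k w \<sigma> = Inf {cost w Cs | Cs. list_all2 (serves U k) \<sigma> Cs}"

text \<open>
  Rounds are numbered from \<open>0\<close>. The next request is the first one strictly after the
  current round; the value is \<open>\<infinity>\<close> if the page is never requested again.
\<close>

definition next_request :: "page list \<Rightarrow> nat \<Rightarrow> page \<Rightarrow> enat" where
  "next_request \<sigma> t p = (INF s \<in> {s. t < s \<and> s < length \<sigma> \<and> \<sigma> ! s = p}. enat s)"

type_synonym observation = "page \<times> (page \<Rightarrow> enat)"

definition observe :: "page list \<Rightarrow> nat \<Rightarrow> observation" where
  "observe \<sigma> t = (\<sigma> ! t, next_request \<sigma> t)"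

text \<open>
  A randomized algorithm knows the page set and the weights in advance. In each round it
  draws its new cache content from a distribution that may depend on all observations up to
  and including the current round and on all its earlier cache contents. As there are only
  countably many finite cache contents, discrete distributions lose no generality, and as
  the whole history is available, this is as general as a distribution over deterministic
  algorithms.
\<close>

type_synonym rand_alg =
  "page set \<Rightarrow> (page \<Rightarrow> real) \<Rightarrow> observation list \<Rightarrow> cache list \<Rightarrow> cache pmf"

definition semi_online_alg :: "nat \<Rightarrow> rand_alg \<Rightarrow> bool" where
  "semi_online_alg k A \<longleftrightarrow>
     (\<forall>U w obs r nxt Cs C. weighted_instance U w \<longrightarrow> r \<in> U \<longrightarrow>
        C \<in> set_pmf (A U w (obs @ [(r, nxt)]) Cs) \<longrightarrow> serves U k r C)"

text \<open>The distribution of the cache contents chosen in the first \<open>t\<close> rounds.\<close>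

primrec run ::
  "(observation list \<Rightarrow> cache list \<Rightarrow> cache pmf) \<Rightarrow> page list \<Rightarrow> nat \<Rightarrow> cache list pmf" where
  "run B \<sigma> 0 = return_pmf []"
| "run B \<sigma> (Suc t) =
     bind_pmf (run B \<sigma> t) (\<lambda>Cs.
       map_pmf (\<lambda>C. Cs @ [C]) (B (map (observe \<sigma>) [0..<Suc t]) Cs))"

definition expected_cost ::
  "rand_alg \<Rightarrow> page set \<Rightarrow> (page \<Rightarrow> real) \<Rightarrow> page list \<Rightarrow> real" where
  "expected_cost A U w \<sigma> = measure_pmf.expectation (run (A U w) \<sigma> (length \<sigma>)) (cost w)"

text \<open>
  The additive constant may depend on everything except the request sequence.
\<close>

definition competitive :: "nat \<Rightarrow> rand_alg \<Rightarrow> real \<Rightarrow> bool" where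
  "competitive k A \<rho> \<longleftrightarrow>
     (\<forall>U w. weighted_instance U w \<longrightarrow>
        (\<exists>a. \<forall>\<sigma>\<in>lists U. expected_cost A U w \<sigma> \<le> \<rho> * opt U k w \<sigma> + a))"

text \<open>The value is \<open>\<infinity>\<close> if the algorithm is not competitive for any real ratio.\<close>

definition competitive_ratio :: "nat \<Rightarrow> rand_alg \<Rightarrow> ereal" where
  "competitive_ratio k A = (INF \<rho> \<in> {\<rho>. competitive k A \<rho>}. ereal \<rho>)"

end

theory Submission
  imports Defs
begin

text \<open>
  The pages are \<open>0, \<dots>, k\<close> with weights \<open>2 ^ p\<close>, so the cache always misses some page (the hole).
  A phase of level \<open>m + 1\<close> consists of \<open>X\<close> phases of level \<open>m\<close>, requests to page \<open>0\<close> that pad it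
  to a fixed length, and the requests \<open>m + 2, m + 1, \<dots>, 0\<close>. After each phase of level \<open>m\<close>
  the adversary stops with probability \<open>1 / 2\<close>; if it has not stopped after \<open>J\<close> of them, exactly
  two more follow. Since all lengths are fixed and every phase ends by requesting all pages that
  occurred in it, the next request times reveal a stopping decision only when it takes effect.

  The algorithm faces a ski rental problem on each level: it either leaves the hole on page
  \<open>m + 2\<close> and pays that page's weight, or suffers the phases of level \<open>m\<close>. The stopping rate is
  such that either way it pays at least \<open>2 ^ (m + 2)\<close> in expectation. Offline, one uses the
  heavy page only if \<open>X > J\<close>. If \<open>2 ^ (m + 1) * x m\<close> bounds the expected offline cost on level
  \<open>m\<close>, this gives \<open>x (m + 1) \<le> \<gamma> * x m + 2 ^ - J + 3 / 2 ^ (m + 2)\<close> with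
  \<open>\<gamma> = 1 - (J + 2) / 2 ^ (J + 1)\<close>. The fixed point is \<open>2 / (J + 2)\<close>, up to the geometrically
  small last term, and for \<open>4 ^ J \<le> k\<close> the \<open>k\<close> levels suffice to get within \<open>O(1 / J)\<close> of it.
\<close>

subsection \<open>Expectations over finite supports\<close>

abbreviation expect :: "'a pmf \<Rightarrow> ('a \<Rightarrow> real) \<Rightarrow> real" where
  "expect \<equiv> measure_pmf.expectation"

lemma expect_eq_sum:
  "finite (set_pmf p) \<Longrightarrow> expect p f = (\<Sum>x\<in>set_pmf p. pmf p x * f x)"
  by (subst integral_measure_pmf_real[of "set_pmf p"]) (auto simp: mult.commute)

lemma expect_bind:
  assumes "finite (set_pmf p)" "\<And>x. x \<in> set_pmf p \<Longrightarrow> finite (set_pmf (q x))"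
  shows "expect (bind_pmf p q) f = expect p (\<lambda>x. expect (q x) f)"
  using assms by (subst pmf_expectation_bind[of "set_pmf p"]) (auto simp: expect_eq_sum)

lemma expect_mono:
  assumes "finite (set_pmf p)" "\<And>x. x \<in> set_pmf p \<Longrightarrow> f x \<le> g x"
  shows "expect p f \<le> expect p g"
  using assms by (auto simp: expect_eq_sum intro!: sum_mono mult_left_mono)

lemma expect_cong:
  assumes "\<And>x. x \<in> set_pmf p \<Longrightarrow> f x = g x"
  shows "expect p f = expect p g"
  using assms by (intro integral_cong_AE) (auto simp: AE_measure_pmf_iff)

lemma expect_add:
  assumes "finite (set_pmf p)"
  shows "expect p (\<lambda>x. f x + g x) = expect p f + expect p g"
  using assms by (simp add: expect_eq_sum sum.distrib algebra_simps)

lemma expect_swap: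
  assumes "finite (set_pmf p)" "finite (set_pmf q)"
  shows "expect p (\<lambda>x. expect q (f x)) = expect q (\<lambda>y. expect p (\<lambda>x. f x y))"
proof -
  have "expect p (\<lambda>x. expect q (f x)) =
      (\<Sum>x\<in>set_pmf p. \<Sum>y\<in>set_pmf q. pmf p x * (pmf q y * f x y))"
    using assms by (simp add: expect_eq_sum sum_distrib_left)
  also have "\<dots> = (\<Sum>y\<in>set_pmf q. \<Sum>x\<in>set_pmf p. pmf p x * (pmf q y * f x y))"
    by (rule sum.swap)
  also have "\<dots> = expect q (\<lambda>y. expect p (\<lambda>x. f x y))"
    using assms by (simp add: expect_eq_sum sum_distrib_left mult.left_commute)
  finally show ?thesis .
qed

subsection \<open>Observations and runs\<close>

text \<open>
  Observations on a piece of the request sequence that starts in round \<open>s\<close>; the last argument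
  gives the first request to each page after that piece.
\<close>

primrec first_from :: "nat \<Rightarrow> page list \<Rightarrow> (page \<Rightarrow> enat) \<Rightarrow> page \<Rightarrow> enat" where
  "first_from s [] f = f"
| "first_from s (r # \<sigma>) f = (first_from (Suc s) \<sigma> f)(r := enat s)"

primrec obs_from :: "nat \<Rightarrow> page list \<Rightarrow> (page \<Rightarrow> enat) \<Rightarrow> observation list" where
  "obs_from s [] f = []"
| "obs_from s (r # \<sigma>) f = (r, first_from (Suc s) \<sigma> f) # obs_from (Suc s) \<sigma> f"

lemma first_from_append:
  "first_from s (\<sigma> @ \<tau>) f = first_from s \<sigma> (first_from (s + length \<sigma>) \<tau> f)"
  by (induction \<sigma> arbitrary: s) auto

lemma obs_from_append:
  "obs_from s (\<sigma> @ \<tau>) f =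
     obs_from s \<sigma> (first_from (s + length \<sigma>) \<tau> f) @ obs_from (s + length \<sigma>) \<tau> f"
  by (induction \<sigma> arbitrary: s) (auto simp: first_from_append)

lemma first_from_notin: "p \<notin> set \<sigma> \<Longrightarrow> first_from s \<sigma> f p = f p"
  by (induction \<sigma> arbitrary: s) auto

text \<open>This is how closing requests hide the future: what follows a piece enters only through
  pages that the piece does not request.\<close>

lemma first_from_cong:
  assumes "\<And>p. p \<notin> set \<sigma> \<Longrightarrow> f p = g p"
  shows "first_from s \<sigma> f = first_from s \<sigma> g"
proof
  fix p show "first_from s \<sigma> f p = first_from s \<sigma> g p"
  proof (cases "p \<in> set \<sigma>")
    case True
    then show ?thesis by (induction \<sigma> arbitrary: s) auto
  qed (use assms in \<open>simp add: first_from_notin\<close>)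
qed

lemma length_obs_from [simp]: "length (obs_from s \<sigma> f) = length \<sigma>"
  by (induction \<sigma> arbitrary: s) auto

lemma map_fst_obs_from [simp]: "map fst (obs_from s \<sigma> f) = \<sigma>"
  by (induction \<sigma> arbitrary: s) auto

section \<open>Next request times read off from the rest of the sequence\<close>

lemma next_request_Suc:
  "next_request \<sigma> t p =
     (if Suc t < length \<sigma> then (if \<sigma> ! Suc t = p then enat (Suc t) else next_request \<sigma> (Suc t) p)
      else \<infinity>)"
proof -
  let ?S = "\<lambda>t. {s. t < s \<and> s < length \<sigma> \<and> \<sigma> ! s = p}"
  have later: "?S t = ?S (Suc t)" if "\<not> (Suc t < length \<sigma> \<and> \<sigma> ! Suc t = p)"
    using that by (auto intro: Suc_lessD) (metis Suc_lessI)
  have "next_request \<sigma> t p = \<infinity>" if "\<not> Suc t < length \<sigma>"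
  proof -
    have empty: "?S t = {}" using that by auto
    show ?thesis unfolding next_request_def empty by (simp add: top_enat_def)
  qed
  moreover have "next_request \<sigma> t p = enat (Suc t)"
    if "Suc t < length \<sigma>" "\<sigma> ! Suc t = p"
    unfolding next_request_def using that
    by (intro antisym INF_lower2[of "Suc t"] INF_greatest) auto
  ultimately show ?thesis
    using later by (cases "Suc t < length \<sigma> \<and> \<sigma> ! Suc t = p")
      (auto simp: next_request_def)
qed

lemma next_request_append:
  "next_request (\<rho> @ r # \<sigma>) (length \<rho>) = first_from (Suc (length \<rho>)) \<sigma> (\<lambda>_. \<infinity>)"
proof (induction \<sigma> arbitrary: \<rho> r)
  case Nil
  show ?case by (rule ext) (subst next_request_Suc, simp)
next
  case (Cons q \<sigma>)
  have "next_request (\<rho> @ r # q # \<sigma>) (Suc (length \<rho>)) =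
      first_from (Suc (Suc (length \<rho>))) \<sigma> (\<lambda>_. \<infinity>)"
    using Cons[of "\<rho> @ [r]" q] by simp
  then show ?case
    by (intro ext) (subst next_request_Suc, auto simp: nth_append)
qed

lemma map_observe: "map (observe \<sigma>) [0..<length \<sigma>] = obs_from 0 \<sigma> (\<lambda>_. \<infinity>)"
proof -
  have "map (observe (\<rho> @ \<sigma>)) [length \<rho>..<length \<rho> + length \<sigma>] =
      obs_from (length \<rho>) \<sigma> (\<lambda>_. \<infinity>)" for \<rho>
  proof (induction \<sigma> arbitrary: \<rho>)
    case (Cons r \<sigma>)
    have "map (observe (\<rho> @ r # \<sigma>)) [Suc (length \<rho>)..<Suc (length \<rho>) + length \<sigma>] =
        obs_from (Suc (length \<rho>)) \<sigma> (\<lambda>_. \<infinity>)"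
      using Cons[of "\<rho> @ [r]"] by simp
    then show ?case
      by (simp add: upt_conv_Cons observe_def[of _ "length \<rho>"] next_request_append del: upt_Suc)
  qed simp
  from this[of "[]"] show ?thesis by simp
qed

text \<open>
  The first two list arguments of \<open>play\<close> are the history; the result contains only the new
  cache contents.
\<close>

primrec play ::
  "(observation list \<Rightarrow> cache list \<Rightarrow> cache pmf) \<Rightarrow> observation list \<Rightarrow> cache list \<Rightarrow>
     observation list \<Rightarrow> cache list pmf" where
  "play B os Cs [] = return_pmf []"
| "play B os Cs (x # xs) =
     bind_pmf (B (os @ [x]) Cs) (\<lambda>C. map_pmf ((#) C) (play B (os @ [x]) (Cs @ [C]) xs))"

lemma play_append:
  "play B os Cs (xs @ ys) =
     bind_pmf (play B os Cs xs) (\<lambda>L. map_pmf ((@) L) (play B (os @ xs) (Cs @ L) ys))"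
proof (induction xs arbitrary: os Cs)
  case Nil
  show ?case by (simp add: bind_return_pmf map_pmf_def bind_return_pmf')
next
  case (Cons x xs)
  then show ?case
    by (simp add: map_pmf_def bind_assoc_pmf bind_return_pmf)
qed

text \<open>\<open>run\<close> adds rounds at the end, while \<open>play\<close> recurses from the
  front and so can be cut at any round and continued from an arbitrary history.\<close>

lemma run_eq_play: "run B \<sigma> t = play B [] [] (map (observe \<sigma>) [0..<t])"
proof (induction t)
  case (Suc t)
  then show ?case
    by (simp add: play_append map_pmf_def bind_assoc_pmf bind_return_pmf)
qed simp

definition serving :: "nat \<Rightarrow> (observation list \<Rightarrow> cache list \<Rightarrow> cache pmf) \<Rightarrow> bool" where
  "serving k B \<longleftrightarrow> (\<forall>os r nxt Cs. r \<le> k \<longrightarrow>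
     (\<forall>C\<in>set_pmf (B (os @ [(r, nxt)]) Cs). serves {..k} k r C))"

lemma play_serves:
  assumes "serving k B" "L \<in> set_pmf (play B os Cs xs)" "set (map fst xs) \<subseteq> {..k}"
  shows "list_all2 (serves {..k} k) (map fst xs) L"
  using assms(2,3)
proof (induction xs arbitrary: os Cs L)
  case (Cons x xs)
  then show ?case using assms(1)
    by (cases x) (fastforce simp: serving_def)
qed auto

text \<open>All caches are subsets of \<open>{..k}\<close>, so every expectation over runs is a
  finite sum and integrability is no concern.\<close>

lemma finite_play:
  assumes "serving k B" "set (map fst xs) \<subseteq> {..k}"
  shows "finite (set_pmf (play B os Cs xs))"
proof (rule finite_subset)
  show "set_pmf (play B os Cs xs) \<subseteq> {L. set L \<subseteq> Pow {..k} \<and> length L = length xs}"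
  proof
    fix L assume "L \<in> set_pmf (play B os Cs xs)"
    then have L: "list_all2 (serves {..k} k) (map fst xs) L"
      using play_serves assms by blast
    then have "set L \<subseteq> Pow {..k}"
      by (fastforce simp: list_all2_conv_all_nth in_set_conv_nth serves_def)
    with L show "L \<in> {L. set L \<subseteq> Pow {..k} \<and> length L = length xs}"
      by (auto dest: list_all2_lengthD)
  qed
  show "finite {L. set L \<subseteq> Pow {..k} \<and> length L = length xs}"
    by (rule finite_lists_length_eq) auto
qed

subsection \<open>Counting gaps\<close>

text \<open>
  The maximal runs of rounds without page \<open>p\<close>; a run at the end of the list counts as well, as
  \<open>p\<close> will have to be loaded in the closing requests.
\<close>

primrec gaps :: "page \<Rightarrow> cache list \<Rightarrow> real" where
  "gaps p [] = 0"
| "gaps p (C # L) = (if p \<notin> C \<and> (L = [] \<or> p \<in> hd L) then 1 else 0) + gaps p L"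

lemma gaps_nonneg: "0 \<le> gaps p L"
  by (induction L) auto

lemma gaps_ge_1: "C \<in> set L \<Longrightarrow> p \<notin> C \<Longrightarrow> 1 \<le> gaps p L"
proof (induction L arbitrary: C)
  case (Cons D L)
  show ?case
  proof (cases "p \<notin> D \<and> (L = [] \<or> p \<in> hd L)")
    case True
    then show ?thesis using gaps_nonneg[of p L] by simp
  next
    case False
    then obtain E where "E \<in> set L" "p \<notin> E"
      using Cons.prems by (metis hd_in_set length_greater_0_conv length_pos_if_in_set set_ConsD)
    then show ?thesis using Cons.IH[of E] by simp
  qed
qed simp

lemma gaps_append_right: "gaps p M \<le> gaps p (K @ M)"
  by (induction K) auto

text \<open>A gap reaching the end of \<open>L\<close> is counted in \<open>L\<close>; the cache
  \<open>D\<close> ends it before \<open>M\<close> starts, so it cannot merge with a gap counted in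
  \<open>M\<close>.\<close>

lemma gaps_separated:
  assumes "D \<in> set K" "p \<in> D"
  shows "gaps p L + gaps p M \<le> gaps p (L @ K @ M)"
proof (induction L)
  case Nil
  show ?case by (simp add: gaps_append_right)
next
  case (Cons C L)
  have *: "(if p \<notin> C then 1 else 0) + gaps p M \<le> gaps p (C # K @ M)" for C
    using assms
  proof (induction K arbitrary: C)
    case (Cons E K)
    show ?case
    proof (cases "p \<in> E")
      case True
      then show ?thesis using gaps_append_right[of p M K] by simp
    next
      case False
      then have "1 + gaps p M \<le> gaps p (E # K @ M)"
        using Cons.IH[of E] Cons.prems by auto
      then show ?thesis
        using gaps_nonneg[of p M] by (simp del: gaps.simps add: gaps.simps(2)[of p C])
    qed
  qed simp
  show ?case
  proof (cases L)
    case Nil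
    then show ?thesis using *[of C] by simp
  next
    case (Cons E L')
    then show ?thesis using \<open>gaps p L + gaps p M \<le> gaps p (L @ K @ M)\<close> by auto
  qed
qed

text \<open>Every gap but a final one ends with a load of its page; the final gaps, at most one per
  page, account for the sum of all weights.\<close>

lemma cost_from_ge_gaps:
  assumes "\<Union>(set L) \<subseteq> {..k}" "\<And>p. p \<le> k \<Longrightarrow> 0 \<le> w p"
  shows "(\<Sum>p\<le>k. w p * gaps p L) \<le> cost_from w C L + (\<Sum>p\<le>k. w p)"
proof -
  have "(\<Sum>p\<le>k. w p * gaps p (C # L)) \<le> cost_from w C L + (\<Sum>p\<le>k. w p)"
    using assms(1)
  proof (induction L arbitrary: C)
    case Nil
    then show ?case using assms(2) by (auto intro!: sum_mono)
  next
    case (Cons D L)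
    have "(\<Sum>p\<le>k. w p * (if p \<notin> C \<and> p \<in> D then 1 else 0)) = (\<Sum>p\<in>D - C. w p)"
      using Cons.prems by (intro sum.mono_neutral_cong_right) auto
    then show ?case using Cons.IH[of D] Cons.prems
      by (simp add: distrib_left sum.distrib)
  qed
  moreover have "(\<Sum>p\<le>k. w p * gaps p L) \<le> (\<Sum>p\<le>k. w p * gaps p (C # L))"
    using assms(2) by (intro sum_mono mult_left_mono) auto
  ultimately show ?thesis by linarith
qed

subsection \<open>Phases\<close>

definition closing :: "nat \<Rightarrow> page list" where
  "closing m = rev [0..<m + 2]"

lemma length_closing [simp]: "length (closing m) = m + 2"
  by (simp add: closing_def)

lemma set_closing [simp]: "set (closing m) = {..Suc m}"
  by (auto simp: closing_def)

text \<open>The subtraction truncates, so \<open>N = 0\<close> means no padding.\<close>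

definition assemble :: "nat \<Rightarrow> nat \<Rightarrow> nat \<Rightarrow> page list list \<Rightarrow> page list" where
  "assemble m l N bs =
     concat (map (\<lambda>b. b @ closing m) bs) @ replicate (N - length bs * (l + m + 2)) 0"

lemma assemble_Cons: "assemble m l N (b # bs) = b @ closing m @ assemble m l (N - (l + m + 2)) bs"
  by (simp add: assemble_def)

lemma set_assemble: "(\<And>b. b \<in> set bs \<Longrightarrow> set b \<subseteq> {..Suc m}) \<Longrightarrow> set (assemble m l N bs) \<subseteq> {..Suc m}"
  by (auto simp: assemble_def)

lemma length_assemble:
  assumes "\<And>b. b \<in> set bs \<Longrightarrow> length b = l" "length bs * (l + m + 2) \<le> N"
  shows "length (assemble m l N bs) = N"
proof -
  have "length (concat (map (\<lambda>b. b @ closing m) bs)) = length bs * (l + m + 2)"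
    using assms(1) by (induction bs) (auto simp: algebra_simps)
  then show ?thesis using assms(2) by (simp add: assemble_def)
qed

text \<open>Each coin is independent of the block before it. Once the list of biases is exhausted,
  no further block follows.\<close>

primrec rounds :: "page list pmf \<Rightarrow> real list \<Rightarrow> page list list pmf" where
  "rounds D [] = return_pmf []"
| "rounds D (\<theta> # \<theta>s) =
     bind_pmf D (\<lambda>b. bind_pmf (bernoulli_pmf \<theta>) (\<lambda>stop.
       if stop then return_pmf [b] else map_pmf ((#) b) (rounds D \<theta>s)))"

lemma set_rounds:
  "bs \<in> set_pmf (rounds D \<theta>s) \<Longrightarrow>
     set bs \<subseteq> set_pmf D \<and> length bs \<le> length \<theta>s \<and> (bs = [] \<longleftrightarrow> \<theta>s = [])"
proof (induction \<theta>s arbitrary: bs)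
  case (Cons \<theta> \<theta>s)
  from Cons.prems obtain b bs' where "b \<in> set_pmf D"
    "bs = [b] \<or> bs = b # bs' \<and> bs' \<in> set_pmf (rounds D \<theta>s)"
    by (auto split: if_splits)
  then show ?case
  proof (cases "bs = [b]")
    case False
    with \<open>bs = [b] \<or> _\<close> have "bs = b # bs'" "bs' \<in> set_pmf (rounds D \<theta>s)" by auto
    then show ?thesis using Cons.IH[of bs'] \<open>b \<in> set_pmf D\<close> by simp
  qed (use \<open>b \<in> set_pmf D\<close> in simp)
qed simp

lemma finite_rounds: "finite (set_pmf D) \<Longrightarrow> finite (set_pmf (rounds D \<theta>s))"
  by (induction \<theta>s) auto

lemma expect_rounds:
  assumes "finite (set_pmf D)" "0 \<le> \<theta>" "\<theta> \<le> 1"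
  shows "expect (rounds D (\<theta> # \<theta>s)) f =
    expect D (\<lambda>b. \<theta> * f [b] + (1 - \<theta>) * expect (rounds D \<theta>s) (\<lambda>bs. f (b # bs)))"
proof -
  have "expect (rounds D (\<theta> # \<theta>s)) f = expect D (\<lambda>b. expect (bernoulli_pmf \<theta>) (\<lambda>stop.
      expect (if stop then return_pmf [b] else map_pmf ((#) b) (rounds D \<theta>s)) f))"
    using assms by (simp add: expect_bind finite_rounds)
  then show ?thesis using assms by (simp add: mult.commute)
qed

text \<open>
  The last condition says that the first requests in a phase carry no information about it.
\<close>

definition regular :: "nat \<Rightarrow> nat \<Rightarrow> page list pmf \<Rightarrow> bool" where
  "regular m l D \<longleftrightarrow> finite (set_pmf D) \<and>
     (\<forall>b\<in>set_pmf D. length b = l \<and> set b \<subseteq> {..Suc m}) \<and>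
     (\<forall>b\<in>set_pmf D. \<forall>b'\<in>set_pmf D. \<forall>s f.
        first_from s (b @ closing m) f = first_from s (b' @ closing m) f)"

lemma regularD:
  assumes "regular m l D"
  shows "finite (set_pmf D)" "b \<in> set_pmf D \<Longrightarrow> length b = l" "b \<in> set_pmf D \<Longrightarrow> set b \<subseteq> {..Suc m}"
    "b \<in> set_pmf D \<Longrightarrow> b' \<in> set_pmf D \<Longrightarrow>
       first_from s (b @ closing m) f = first_from s (b' @ closing m) f"
  using assms unfolding regular_def by blast+

text \<open>The closing requests of the first block cover all pages up to \<open>m + 1\<close>, so
  later blocks and padding change no first request; regularity makes the first block itself
  exchangeable.\<close>

lemma first_from_assemble:
  assumes "regular m l D" "b \<in> set_pmf D" "b' \<in> set_pmf D"
    "set bs \<subseteq> set_pmf D"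
  shows "first_from s (assemble m l N (b # bs)) f = first_from s (b' @ closing m) f"
proof -
  note D = regularD[OF assms(1)]
  have "first_from s (assemble m l N (b # bs)) f =
      first_from s (b @ closing m) (first_from (s + (l + m + 2)) (assemble m l (N - (l + m + 2)) bs) f)"
    using D(2)[OF assms(2)]
    by (subst assemble_Cons, subst append_assoc [symmetric], subst first_from_append)
      (simp add: algebra_simps)
  also have "\<dots> = first_from s (b @ closing m) f"
  proof (rule first_from_cong)
    fix p assume "p \<notin> set (b @ closing m)"
    moreover have "set (assemble m l (N - (l + m + 2)) bs) \<subseteq> {..Suc m}"
      using assms(4) D(3) by (intro set_assemble) blast
    ultimately show "first_from (s + (l + m + 2)) (assemble m l (N - (l + m + 2)) bs) f p = f p"
      by (intro first_from_notin) auto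
  qed
  also have "\<dots> = first_from s (b' @ closing m) f"
    using D(4) assms(2,3) .
  finally show ?thesis .
qed

text \<open>There is a first block because \<open>\<theta>s\<close> is nonempty, and it fixes the
  first requests to pages up to \<open>m + 1\<close>. Padding to length \<open>N\<close> puts all
  that follows into the same rounds for every outcome.\<close>

lemma regular_assemble:
  assumes D: "regular m l D" and "\<theta>s \<noteq> []" and N: "length \<theta>s * (l + m + 2) \<le> N"
  shows "regular (Suc m) N (map_pmf (assemble m l N) (rounds D \<theta>s))"
proof -
  have supp: "length (assemble m l N bs) = N \<and> set (assemble m l N bs) \<subseteq> {..Suc (Suc m)}"
    if "bs \<in> set_pmf (rounds D \<theta>s)" for bs
  proof
    have "length bs * (l + m + 2) \<le> length \<theta>s * (l + m + 2)"
      using set_rounds[OF that] by (intro mult_right_mono) auto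
    then show "length (assemble m l N bs) = N"
      using set_rounds[OF that] regularD(2)[OF D] N by (intro length_assemble) auto
    have "set (assemble m l N bs) \<subseteq> {..Suc m}"
      using set_rounds[OF that] regularD(3)[OF D] by (intro set_assemble) blast
    then show "set (assemble m l N bs) \<subseteq> {..Suc (Suc m)}" by auto
  qed
  have first: "first_from s (assemble m l N bs @ closing (Suc m)) f =
      first_from s (assemble m l N bs' @ closing (Suc m)) f"
    if "bs \<in> set_pmf (rounds D \<theta>s)" "bs' \<in> set_pmf (rounds D \<theta>s)" for bs bs' s f
  proof -
    have "bs \<noteq> []" "bs' \<noteq> []"
      using set_rounds that assms(2) by blast+
    then obtain b r b' r' where bs: "bs = b # r" "bs' = b' # r'"
      by (meson neq_Nil_conv)
    then have "b \<in> set_pmf D" "set r \<subseteq> set_pmf D" "b' \<in> set_pmf D" "set r' \<subseteq> set_pmf D"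
      using set_rounds[OF that(1)] set_rounds[OF that(2)] by auto
    with bs supp[OF that(1)] supp[OF that(2)] show ?thesis
      by (simp add: first_from_append[of _ "assemble m l N _"] first_from_assemble[OF D, of _ b'])
  qed
  have "finite (set_pmf (rounds D \<theta>s))"
    using regularD(1)[OF D] by (rule finite_rounds)
  then show ?thesis
    unfolding regular_def set_map_pmf using supp first
    by (intro conjI ballI allI finite_imageI; (elim imageE)?; hypsubst?) blast+
qed

section \<open>Costs charged to a phase\<close>

definition miss_cost :: "nat \<Rightarrow> cache list \<Rightarrow> real" where
  "miss_cost m L = (\<Sum>p\<le>Suc m. 2 ^ p * gaps p L)"

text \<open>The hole stays among the pages up to \<open>m + 1\<close>, phrased so that several pages
  may be missing at once.\<close>

definition full_above :: "nat \<Rightarrow> nat \<Rightarrow> cache list \<Rightarrow> bool" where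
  "full_above k m L \<longleftrightarrow> (\<forall>C\<in>set L. {Suc m<..k} \<subseteq> C)"

definition excess :: "nat \<Rightarrow> nat \<Rightarrow> cache list \<Rightarrow> real" where
  "excess k m L = miss_cost m L - (if full_above k m L then 2 ^ Suc m else 0)"

text \<open>
  Everything after the first phase in which the hole was above page \<open>m + 1\<close> is dropped. Up to
  then each phase is credited \<open>\<kappa>\<close>, and a hole that is still low in the end is charged \<open>\<tau>\<close>. With
  \<open>\<kappa> = 2 ^ (m + 1)\<close> and \<open>\<tau> = 2 * \<kappa>\<close> the credit cancels the subtrahend of \<open>excess\<close>; the choice
  \<open>\<kappa> = \<tau> = 0\<close> serves the top level, where no page is above.
\<close>

primrec potential ::
  "nat \<Rightarrow> nat \<Rightarrow> nat \<Rightarrow> real \<Rightarrow> real \<Rightarrow> nat \<Rightarrow> cache list \<Rightarrow> real" where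
  "potential k m l \<kappa> \<tau> 0 L = - \<tau>"
| "potential k m l \<kappa> \<tau> (Suc x) L = excess k m (take l L) +
     (if full_above k m (take l L) then \<kappa> + potential k m l \<kappa> \<tau> x (drop (l + m + 2) L) else 0)"

lemma miss_cost_nonneg: "0 \<le> miss_cost m L"
  unfolding miss_cost_def by (intro sum_nonneg mult_nonneg_nonneg gaps_nonneg) auto

lemma miss_cost_separated:
  assumes "list_all2 (\<in>) (closing m) K"
  shows "miss_cost m L + miss_cost m M \<le> miss_cost m (L @ K @ M)"
proof -
  have "gaps p L + gaps p M \<le> gaps p (L @ K @ M)" if "p \<le> Suc m" for p
  proof -
    have "p \<in> set (closing m)" using that by simp
    then obtain C where "C \<in> set K" "p \<in> C"
      using assms by (metis in_set_conv_nth list_all2_conv_all_nth)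
    then show ?thesis by (rule gaps_separated)
  qed
  then show ?thesis
    unfolding miss_cost_def sum.distrib [symmetric] distrib_left [symmetric]
    by (intro sum_mono mult_left_mono) auto
qed

lemma list_all2_assemble_Cons:
  assumes "list_all2 P (assemble m l N (b # bs)) L" "length b = l"
  obtains L1 K M where "L = L1 @ K @ M" "length L1 = l" "length K = m + 2"
    "list_all2 P (closing m) K" "list_all2 P (assemble m l (N - (l + m + 2)) bs) M"
proof -
  obtain L1 L2 where "L = L1 @ L2" and L1: "list_all2 P b L1"
    and "list_all2 P (closing m @ assemble m l (N - (l + m + 2)) bs) L2"
    using assms(1) unfolding assemble_Cons list_all2_append1 by blast
  moreover from this obtain K M where "L2 = K @ M" "list_all2 P (closing m) K"
    "list_all2 P (assemble m l (N - (l + m + 2)) bs) M"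
    unfolding list_all2_append1 by blast
  moreover have "length L1 = l" "length K = m + 2"
    using L1 calculation(5) assms(2) by (auto dest!: list_all2_lengthD)
  ultimately show thesis using that by blast
qed

text \<open>If the hole stays low in every block, the block costs add up and \<open>- \<tau>\<close>
  pays for the indicator on the right. If it rises in some block, the indicator vanishes and the
  dropped remainder has nonnegative cost.\<close>

lemma potential_le_miss_cost:
  assumes "list_all2 (\<in>) (assemble m l N bs) L" "\<And>b. b \<in> set bs \<Longrightarrow> length b = l"
  shows "potential k m l (2 ^ Suc m) (2 ^ Suc (Suc m)) (length bs) L \<le>
    miss_cost m L - (if full_above k m L then 2 ^ Suc (Suc m) else 0)"
  using assms
proof (induction bs arbitrary: L N)
  case Nil
  then show ?case
    using miss_cost_nonneg[of m L] zero_le_power[of "2::real" m] by (auto simp del: zero_le_power)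
next
  case (Cons b bs)
  from Cons.prems(1) obtain L1 K M where L: "L = L1 @ K @ M"
    and len: "length L1 = l" "length K = m + 2" and K: "list_all2 (\<in>) (closing m) K"
    and M: "list_all2 (\<in>) (assemble m l (N - (l + m + 2)) bs) M"
    by (rule list_all2_assemble_Cons) (simp add: Cons.prems(2))
  have "full_above k m L \<Longrightarrow> full_above k m L1 \<and> full_above k m M"
    by (auto simp: L full_above_def)
  moreover have "potential k m l (2 ^ Suc m) (2 ^ Suc (Suc m)) (length bs) M \<le> miss_cost m M"
    by (rule order_trans[OF Cons.IH[OF M]]) (use Cons.prems(2) in auto)
  ultimately show ?case
    using Cons.IH[OF M] Cons.prems(2) miss_cost_separated[OF K, of L1 M] miss_cost_nonneg[of m M]
    by (auto simp: L len excess_def split: if_splits)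
qed

text \<open>No page lies above \<open>m + 1\<close>, so nothing is ever dropped and every block
  contributes its \<open>excess\<close> with the subtrahend.\<close>

lemma potential_le_miss_cost_top:
  assumes "list_all2 (\<in>) (assemble m l N bs) L" "\<And>b. b \<in> set bs \<Longrightarrow> length b = l" "k = Suc m"
  shows "potential k m l 0 0 (length bs) L \<le> miss_cost m L - length bs * 2 ^ Suc m"
  using assms(1,2)
proof (induction bs arbitrary: L N)
  case Nil
  then show ?case using miss_cost_nonneg[of m L] by simp
next
  case (Cons b bs)
  from Cons.prems(1) obtain L1 K M where L: "L = L1 @ K @ M"
    and len: "length L1 = l" "length K = m + 2" and K: "list_all2 (\<in>) (closing m) K"
    and M: "list_all2 (\<in>) (assemble m l (N - (l + m + 2)) bs) M"
    by (rule list_all2_assemble_Cons) (simp add: Cons.prems(2))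
  show ?case
    using Cons.IH[OF M] Cons.prems(2) miss_cost_separated[OF K, of L1 M] assms(3)
    by (auto simp: L len excess_def full_above_def algebra_simps split: if_splits)
qed

subsection \<open>The online cost of a phase\<close>

text \<open>The value of an optimal stopping problem: \<open>0\<close> stands for raising the hole
  in the current block, the other argument of \<open>min\<close> for keeping it low, with charge
  \<tau> if the adversary stops and the remaining value otherwise.\<close>

primrec worth :: "real \<Rightarrow> real \<Rightarrow> real list \<Rightarrow> real" where
  "worth \<kappa> \<tau> [] = - \<tau>"
| "worth \<kappa> \<tau> (\<theta> # \<theta>s) = min 0 (\<kappa> - \<theta> * \<tau> + (1 - \<theta>) * worth \<kappa> \<tau> \<theta>s)"

text \<open>
  The expected cost on pages up to \<open>m + 1\<close> is at least \<open>2 ^ (m + 1)\<close> times the probability that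
  the hole never leaves these pages, whatever the history and the requests after the phase.
\<close>

definition hard ::
  "nat \<Rightarrow> (observation list \<Rightarrow> cache list \<Rightarrow> cache pmf) \<Rightarrow> nat \<Rightarrow> nat \<Rightarrow> page list pmf \<Rightarrow> bool" where
  "hard k B m l D \<longleftrightarrow> (\<forall>os Cs s f. 0 \<le> expect D (\<lambda>b.
     expect (play B os Cs (obs_from s b (first_from (s + l) (closing m) f))) (excess k m)))"

text \<open>During the body of the first block the closing requests mask the later blocks, so the
  observations do not reveal whether the adversary stops.\<close>

lemma obs_from_assemble_Cons:
  assumes "length b = l" "\<And>c. c \<in> set r \<Longrightarrow> set c \<subseteq> {..Suc m}"
  shows "obs_from s (assemble m l N (b # r)) f =
    obs_from s b (first_from (s + l) (closing m) f) @
    obs_from (s + l) (closing m)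
      (first_from (s + (l + m + 2)) (assemble m l (N - (l + m + 2)) r) f) @
    obs_from (s + (l + m + 2)) (assemble m l (N - (l + m + 2)) r) f"
proof -
  let ?R = "assemble m l (N - (l + m + 2)) r"
  have "set ?R \<subseteq> {..Suc m}"
    using assms(2) by (rule set_assemble)
  then have mask: "first_from (s + l) (closing m) (first_from (s + (l + m + 2)) ?R f) =
      first_from (s + l) (closing m) f"
    by (intro first_from_cong first_from_notin) auto
  have shift: "s + l + (m + 2) = s + (l + m + 2)" by simp
  show ?thesis
    by (simp only: assemble_Cons obs_from_append first_from_append length_closing assms(1) shift mask)
qed

lemma length_play: "L \<in> set_pmf (play B os Cs xs) \<Longrightarrow> length L = length xs"
  by (induction xs arbitrary: os Cs L) auto

lemma potential_0: "potential k m l \<kappa> \<tau> 0 = (\<lambda>_. - \<tau>)"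
  by (rule ext) simp

lemma expect_play_assemble_Cons:
  fixes s l m N :: nat and f
  assumes B: "serving k B" and m: "Suc m \<le> k" and b: "length b = l" "set b \<subseteq> {..Suc m}"
    and r: "\<And>c. c \<in> set r \<Longrightarrow> set c \<subseteq> {..Suc m}"
  defines "t \<equiv> s + (l + m + 2)" and "R \<equiv> assemble m l (N - (l + m + 2)) r"
  defines "bo \<equiv> obs_from s b (first_from (s + l) (closing m) f)"
    and "co \<equiv> obs_from (s + l) (closing m) (first_from t R f)"
  shows "expect (play B os Cs (obs_from s (assemble m l N (b # r)) f))
      (potential k m l \<kappa> \<tau> (Suc x)) =
    expect (play B os Cs bo) (\<lambda>L. excess k m L +
      (if full_above k m L then \<kappa> + expect (play B (os @ bo) (Cs @ L) co) (\<lambda>K.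
         expect (play B (os @ bo @ co) (Cs @ L @ K) (obs_from t R f)) (potential k m l \<kappa> \<tau> x))
       else 0))"
proof -
  have "set R \<subseteq> {..Suc m}" unfolding R_def using r by (rule set_assemble)
  then have fin: "finite (set_pmf (play B os Cs bo))" "finite (set_pmf (play B os Cs co))"
    "finite (set_pmf (play B os Cs (obs_from t R f)))" for os Cs
    using b m B by (auto intro!: finite_play simp: bo_def co_def simp flip: set_map)
  have obs: "obs_from s (assemble m l N (b # r)) f = bo @ co @ obs_from t R f"
    unfolding bo_def co_def t_def R_def using b(1) r by (rule obs_from_assemble_Cons)
  have "expect (play B os Cs (obs_from s (assemble m l N (b # r)) f))
      (potential k m l \<kappa> \<tau> (Suc x)) =
    expect (play B os Cs bo) (\<lambda>L. expect (play B (os @ bo) (Cs @ L) co) (\<lambda>K.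
      expect (play B (os @ bo @ co) (Cs @ L @ K) (obs_from t R f))
        (\<lambda>M. potential k m l \<kappa> \<tau> (Suc x) (L @ K @ M))))"
    using fin by (simp add: obs play_append expect_bind integral_map_pmf del: potential.simps)
  \<comment> \<open>Written with the indicator as a factor, the integrand is affine in the later
    potential, and linearity applies.\<close>
  also have "\<dots> = expect (play B os Cs bo) (\<lambda>L. expect (play B (os @ bo) (Cs @ L) co) (\<lambda>K.
      expect (play B (os @ bo @ co) (Cs @ L @ K) (obs_from t R f))
        (\<lambda>M. (excess k m L + (if full_above k m L then \<kappa> else 0)) +
           (if full_above k m L then 1 else 0) * potential k m l \<kappa> \<tau> x M)))"
  proof (intro expect_cong)
    fix L K M
    assume "L \<in> set_pmf (play B os Cs bo)" "K \<in> set_pmf (play B (os @ bo) (Cs @ L) co)"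
    then have "length L = l" "length K = m + 2"
      using b(1) by (auto simp: bo_def co_def dest!: length_play)
    then show "potential k m l \<kappa> \<tau> (Suc x) (L @ K @ M) =
      (excess k m L + (if full_above k m L then \<kappa> else 0)) +
           (if full_above k m L then 1 else 0) * potential k m l \<kappa> \<tau> x M"
      by simp
  qed
  also have "\<dots> = expect (play B os Cs bo) (\<lambda>L. excess k m L +
      (if full_above k m L then \<kappa> + expect (play B (os @ bo) (Cs @ L) co) (\<lambda>K.
         expect (play B (os @ bo @ co) (Cs @ L @ K) (obs_from t R f)) (potential k m l \<kappa> \<tau> x))
       else 0))"
    using fin by (intro expect_cong) (simp add: expect_add)
  finally show ?thesis .
qed

text \<open>Backward induction on the coins. The body of a block is played before its coin becomes
  visible, and \<open>hard\<close> makes the expected excess there nonnegative, so only the stopping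
  problem remains.\<close>

lemma worth_le_potential:
  assumes B: "serving k B" and m: "Suc m \<le> k" and D: "regular m l D" and hard: "hard k B m l D"
    and \<theta>s: "set \<theta>s \<subseteq> {0..1}"
  shows "worth \<kappa> \<tau> \<theta>s \<le> expect (rounds D \<theta>s) (\<lambda>bs.
    expect (play B os Cs (obs_from s (assemble m l N bs) f)) (potential k m l \<kappa> \<tau> (length bs)))"
  using \<theta>s
proof (induction \<theta>s arbitrary: os Cs s N)
  case Nil
  show ?case by (simp add: potential_0)
next
  case (Cons \<theta> \<theta>s)
  define t where "t = s + (l + m + 2)"
  define R where "R r = assemble m l (N - (l + m + 2)) r" for r
  define bo where "bo b = obs_from s b (first_from (s + l) (closing m) f)" for b
  define co where "co r = obs_from (s + l) (closing m) (first_from t (R r) f)" for r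
  define F where "F bs = expect (play B os Cs (obs_from s (assemble m l N bs) f))
    (potential k m l \<kappa> \<tau> (length bs))" for bs
  define V where "V b r L = expect (play B (os @ bo b) (Cs @ L) (co r)) (\<lambda>K.
    expect (play B (os @ bo b @ co r) (Cs @ L @ K) (obs_from t (R r) f))
      (potential k m l \<kappa> \<tau> (length r)))" for b r L
  note D' = regularD[OF D]
  have finr: "finite (set_pmf (rounds D \<theta>s))" by (rule finite_rounds) (rule D')
  have \<theta>: "0 \<le> \<theta>" "\<theta> \<le> 1" using Cons.prems by auto
  have bodies: "set c \<subseteq> {..Suc m}" if "r \<in> set_pmf (rounds D \<theta>s)" "c \<in> set r" for r c
    using set_rounds[OF that(1)] that(2) D'(3) by blast
  have F: "F (b # r) = expect (play B os Cs (bo b)) (\<lambda>L. excess k m L +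
      (if full_above k m L then \<kappa> + V b r L else 0))"
    if "b \<in> set_pmf D" "\<And>c. c \<in> set r \<Longrightarrow> set c \<subseteq> {..Suc m}" for b r
    unfolding F_def V_def t_def R_def bo_def co_def list.size(4) add_0_right
    using expect_play_assemble_Cons[OF B m D'(2,3)[OF that(1)] that(2)] by simp
  have V_Nil: "V b [] L = - \<tau>" for b L
    by (simp add: V_def potential_0)
  have V_rounds: "worth \<kappa> \<tau> \<theta>s \<le> expect (rounds D \<theta>s) (\<lambda>r. V b r L)" for b L
  proof -
    \<comment> \<open>Given that the adversary goes on, regularity makes the observations in the
      closing requests the same for all remaining blocks \<open>r\<close>. These are thus still
      random once \<open>K\<close> is fixed, and the induction hypothesis applies.\<close>
    have "\<exists>g. \<forall>r\<in>set_pmf (rounds D \<theta>s). first_from t (R r) f = g"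
    proof (cases \<theta>s)
      case (Cons \<theta>' \<theta>s')
      obtain b0 where b0: "b0 \<in> set_pmf D" using set_pmf_not_empty by fast
      have "first_from t (R r) f = first_from t (b0 @ closing m) f"
        if r: "r \<in> set_pmf (rounds D \<theta>s)" for r
      proof -
        obtain c r' where "r = c # r'" "c \<in> set_pmf D" "set r' \<subseteq> set_pmf D"
          using set_rounds[OF r] Cons by (cases r) auto
        then show ?thesis
          unfolding R_def using first_from_assemble[OF D _ b0] by simp
      qed
      then show ?thesis by blast
    qed simp
    then obtain g where g: "\<And>r. r \<in> set_pmf (rounds D \<theta>s) \<Longrightarrow> first_from t (R r) f = g"
      by blast
    define co' where "co' = obs_from (s + l) (closing m) g"
    have finK: "finite (set_pmf (play B (os @ bo b) (Cs @ L) co'))"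
      using B m by (intro finite_play) (auto simp: co'_def simp flip: set_map)
    have "worth \<kappa> \<tau> \<theta>s = expect (play B (os @ bo b) (Cs @ L) co') (\<lambda>K. worth \<kappa> \<tau> \<theta>s)"
      by simp
    also have "\<dots> \<le> expect (play B (os @ bo b) (Cs @ L) co') (\<lambda>K. expect (rounds D \<theta>s) (\<lambda>r.
        expect (play B (os @ bo b @ co') (Cs @ L @ K) (obs_from t (R r) f))
          (potential k m l \<kappa> \<tau> (length r))))"
      unfolding R_def using Cons.prems finK by (intro expect_mono Cons.IH) auto
    also have "\<dots> = expect (rounds D \<theta>s) (\<lambda>r. expect (play B (os @ bo b) (Cs @ L) co') (\<lambda>K.
        expect (play B (os @ bo b @ co') (Cs @ L @ K) (obs_from t (R r) f))
          (potential k m l \<kappa> \<tau> (length r))))"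
      using finK finr by (rule expect_swap)
    also have "\<dots> = expect (rounds D \<theta>s) (\<lambda>r. V b r L)"
      unfolding V_def co_def co'_def by (intro expect_cong) (simp add: g)
    finally show ?thesis .
  qed
  have step: "expect (play B os Cs (bo b)) (excess k m) + worth \<kappa> \<tau> (\<theta> # \<theta>s) \<le>
      \<theta> * F [b] + (1 - \<theta>) * expect (rounds D \<theta>s) (\<lambda>bs. F (b # bs))"
    if b: "b \<in> set_pmf D" for b
  proof -
    let ?P = "play B os Cs (bo b)"
    have fin: "finite (set_pmf ?P)"
      using m D'(3)[OF b] by (intro finite_play[OF B]) (auto simp: bo_def simp flip: set_map)
    have "expect (rounds D \<theta>s) (\<lambda>r. F (b # r)) = expect (rounds D \<theta>s) (\<lambda>r.
        expect ?P (\<lambda>L. excess k m L + (if full_above k m L then \<kappa> + V b r L else 0)))"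
      using b bodies by (intro expect_cong F)
    also have "\<dots> = expect ?P (\<lambda>L. expect (rounds D \<theta>s) (\<lambda>r.
        excess k m L + (if full_above k m L then \<kappa> + V b r L else 0)))"
      using finr fin by (rule expect_swap)
    also have "\<dots> \<ge> expect ?P (\<lambda>L. excess k m L + (if full_above k m L then \<kappa> + worth \<kappa> \<tau> \<theta>s else 0))"
      using fin V_rounds by (intro expect_mono) (auto simp: expect_add finr)
    finally have cont: "expect ?P (\<lambda>L. excess k m L + (if full_above k m L then \<kappa> + worth \<kappa> \<tau> \<theta>s else 0))
        \<le> expect (rounds D \<theta>s) (\<lambda>r. F (b # r))" .
    have stop: "F [b] = expect ?P (\<lambda>L. excess k m L + (if full_above k m L then \<kappa> - \<tau> else 0))"
      using F[OF b, of "[]"] by (simp add: V_Nil cong: if_cong)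
    have "expect ?P (excess k m) + worth \<kappa> \<tau> (\<theta> # \<theta>s) =
        expect ?P (\<lambda>L. excess k m L + worth \<kappa> \<tau> (\<theta> # \<theta>s))"
      using fin by (simp add: expect_add)
    \<comment> \<open>Pointwise in \<open>L\<close>: a raised hole gives the value \<open>0\<close>,
      a low one the second argument of \<open>min\<close>.\<close>
    also have "\<dots> \<le> expect ?P (\<lambda>L. \<theta> * (excess k m L + (if full_above k m L then \<kappa> - \<tau> else 0)) +
        (1 - \<theta>) * (excess k m L + (if full_above k m L then \<kappa> + worth \<kappa> \<tau> \<theta>s else 0)))"
      using fin by (intro expect_mono) (auto simp: algebra_simps)
    also have "\<dots> = \<theta> * F [b] +
        (1 - \<theta>) * expect ?P (\<lambda>L. excess k m L + (if full_above k m L then \<kappa> + worth \<kappa> \<tau> \<theta>s else 0))"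
      using fin by (simp add: expect_add stop)
    also have "\<dots> \<le> \<theta> * F [b] + (1 - \<theta>) * expect (rounds D \<theta>s) (\<lambda>bs. F (b # bs))"
      using cont \<theta> by (intro add_left_mono mult_left_mono) auto
    finally show ?thesis .
  qed
  have "0 \<le> expect D (\<lambda>b. expect (play B os Cs (bo b)) (excess k m))"
    using hard unfolding hard_def bo_def by blast
  then have "worth \<kappa> \<tau> (\<theta> # \<theta>s) \<le> expect D (\<lambda>b. expect (play B os Cs (bo b)) (excess k m) + worth \<kappa> \<tau> (\<theta> # \<theta>s))"
    using D'(1) by (simp add: expect_add)
  also have "\<dots> \<le> expect D (\<lambda>b. \<theta> * F [b] + (1 - \<theta>) * expect (rounds D \<theta>s) (\<lambda>bs. F (b # bs)))"
    using D'(1) step by (rule expect_mono)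
  also have "\<dots> = expect (rounds D (\<theta> # \<theta>s)) F"
    using D'(1) \<theta> by (rule expect_rounds [symmetric])
  finally show ?case unfolding F_def .
qed

text \<open>The number of blocks is one of \<open>1, ..., J\<close> or equals \<open>J + 2\<close>;
  after the last entry the list of blocks ends anyway.\<close>

definition stops :: "nat \<Rightarrow> real list" where
  "stops J = replicate J (1 / 2) @ [0, 0]"

text \<open>Backwards from \<open>- 2 * \<kappa>\<close>, the two final zeros add \<kappa> each and
  lead to \<open>0\<close>. At a fair coin the credit \<kappa> and the expected charge cancel, so
  the value stays \<open>0\<close>.\<close>

lemma worth_stops: "0 \<le> \<kappa> \<Longrightarrow> worth \<kappa> (2 * \<kappa>) (stops J) = 0"
  by (induction J) (auto simp: stops_def)

lemma worth_zeros: "worth 0 0 (replicate R 0) = 0"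
  by (induction R) auto

text \<open>
  If the hole visits page \<open>m + 2\<close> but no higher page, that page's weight pays for the indicator.
\<close>

lemma excess_Suc_ge:
  assumes "Suc (Suc m) \<le> k"
  shows "miss_cost m L - (if full_above k m L then 2 ^ Suc (Suc m) else 0) \<le> excess k (Suc m) L"
proof -
  have cost: "miss_cost (Suc m) L = miss_cost m L + 2 ^ Suc (Suc m) * gaps (Suc (Suc m)) L"
    by (simp add: miss_cost_def)
  show ?thesis
  proof (cases "full_above k (Suc m) L \<and> \<not> full_above k m L")
    case True
    then obtain C p where C: "C \<in> set L" and p: "p \<notin> C" "Suc m < p" "p \<le> k"
      unfolding full_above_def by (meson greaterThanAtMost_iff subsetI)
    from True C have "{Suc (Suc m)<..k} \<subseteq> C" unfolding full_above_def by blast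
    with p have "\<not> Suc (Suc m) < p" by auto
    with p have "p = Suc (Suc m)" by simp
    with C p have "1 \<le> gaps (Suc (Suc m)) L" using gaps_ge_1 by blast
    then have "(2::real) ^ Suc (Suc m) * 1 \<le> 2 ^ Suc (Suc m) * gaps (Suc (Suc m)) L"
      by (intro mult_left_mono) auto
    then show ?thesis using True by (simp add: cost excess_def)
  next
    case False
    moreover have "(0::real) \<le> 2 ^ Suc (Suc m) * gaps (Suc (Suc m)) L"
      by (intro mult_nonneg_nonneg gaps_nonneg) auto
    moreover have "full_above k m L \<Longrightarrow> full_above k (Suc m) L"
      unfolding full_above_def by (meson Suc_lessD greaterThanAtMost_iff subset_iff)
    ultimately show ?thesis by (cases "full_above k m L") (simp_all add: cost excess_def)
  qed
qed

lemma play_mem: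
  assumes "serving k B" "set \<sigma> \<subseteq> {..k}" "L \<in> set_pmf (play B os Cs (obs_from s \<sigma> f))"
  shows "list_all2 (\<in>) \<sigma> L"
proof -
  have "list_all2 (serves {..k} k) \<sigma> L"
    using play_serves[OF assms(1,3)] assms(2) by simp
  then show ?thesis by (rule list_all2_mono) (simp add: serves_def)
qed

text \<open>The stopping problem has value \<open>0\<close>, and the charge
  \<open>2 ^ (m + 2)\<close> on a low hole becomes the subtrahend of \<open>excess\<close> one level
  up by \<open>excess_Suc_ge\<close>.\<close>

lemma hard_assemble:
  assumes B: "serving k B" and m: "Suc (Suc m) \<le> k" and D: "regular m l D"
    and hard: "hard k B m l D"
  shows "hard k B (Suc m) N (map_pmf (assemble m l N) (rounds D (stops J)))"
  unfolding hard_def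
proof (intro allI)
  fix os Cs s f
  let ?f = "first_from (s + N) (closing (Suc m)) f"
  have "0 = worth (2 ^ Suc m) (2 * 2 ^ Suc m) (stops J)"
    by (subst worth_stops) auto
  also have "\<dots> \<le> expect (rounds D (stops J)) (\<lambda>bs. expect (play B os Cs
      (obs_from s (assemble m l N bs) ?f)) (potential k m l (2 ^ Suc m) (2 * 2 ^ Suc m) (length bs)))"
    using B m D hard by (intro worth_le_potential) (auto simp: stops_def)
  also have "\<dots> \<le> expect (rounds D (stops J)) (\<lambda>bs. expect (play B os Cs
      (obs_from s (assemble m l N bs) ?f)) (excess k (Suc m)))"
  proof (rule expect_mono)
    show "finite (set_pmf (rounds D (stops J)))" by (rule finite_rounds) (rule regularD[OF D])
    fix bs assume bs: "bs \<in> set_pmf (rounds D (stops J))"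
    then have "set (assemble m l N bs) \<subseteq> {..Suc m}"
      using set_rounds[OF bs] regularD(3)[OF D] by (intro set_assemble) blast
    then have sub: "set (assemble m l N bs) \<subseteq> {..k}" using m by auto
    show "expect (play B os Cs (obs_from s (assemble m l N bs) ?f))
        (potential k m l (2 ^ Suc m) (2 * 2 ^ Suc m) (length bs)) \<le>
      expect (play B os Cs (obs_from s (assemble m l N bs) ?f)) (excess k (Suc m))"
    proof (rule expect_mono)
      show "finite (set_pmf (play B os Cs (obs_from s (assemble m l N bs) ?f)))"
        using B sub by (intro finite_play) auto
      fix L assume "L \<in> set_pmf (play B os Cs (obs_from s (assemble m l N bs) ?f))"
      then have "list_all2 (\<in>) (assemble m l N bs) L"
        by (rule play_mem[OF B sub])
      moreover have "length b = l" if "b \<in> set bs" for b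
        using set_rounds[OF bs] that regularD(2)[OF D] by blast
      ultimately have "potential k m l (2 ^ Suc m) (2 ^ Suc (Suc m)) (length bs) L \<le>
          miss_cost m L - (if full_above k m L then 2 ^ Suc (Suc m) else 0)"
        by (rule potential_le_miss_cost)
      also have "\<dots> \<le> excess k (Suc m) L" using m by (rule excess_Suc_ge)
      finally show "potential k m l (2 ^ Suc m) (2 * 2 ^ Suc m) (length bs) L \<le> excess k (Suc m) L"
        by simp
    qed
  qed
  finally show "0 \<le> expect (map_pmf (assemble m l N) (rounds D (stops J))) (\<lambda>b.
      expect (play B os Cs (obs_from s b ?f)) (excess k (Suc m)))"
    by simp
qed

section \<open>Base level and induction over the levels\<close>

lemma regular_level_0: "regular 0 1 (return_pmf [0])"
  by (simp add: regular_def)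

text \<open>Some page is missing, but not page \<open>0\<close>. If all pages from \<open>2\<close>
  on are present, page \<open>1\<close> is missing, and its weight \<open>2\<close> equals the
  subtrahend.\<close>

lemma hard_level_0:
  assumes B: "serving k B" and "1 \<le> k"
  shows "hard k B 0 1 (return_pmf [0])"
  unfolding hard_def
proof (intro allI)
  fix os Cs s f
  let ?P = "play B os Cs (obs_from s [0] (first_from (s + 1) (closing 0) f))"
  have "0 \<le> excess k 0 L" if L: "L \<in> set_pmf ?P" for L
  proof -
    have "list_all2 (serves {..k} k) [0] L"
      using play_serves[OF B L] by simp
    then obtain C where C: "L = [C]" "C \<subseteq> {..k}" "card C \<le> k" "0 \<in> C"
      by (auto simp: list_all2_Cons1 serves_def)
    have "1 \<notin> C" if "full_above k 0 L"
    proof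
      assume "1 \<in> C"
      have "{Suc 0<..k} \<subseteq> C" using that C(1) by (simp add: full_above_def)
      moreover have "x = 0 \<or> x = 1 \<or> x \<in> {Suc 0<..k}" if "x \<le> k" for x
        using that by auto
      ultimately have "{..k} \<subseteq> C" using \<open>1 \<in> C\<close> C(4) by blast
      with C(2) have "C = {..k}" by (rule subset_antisym)
      with C(3) show False by simp
    qed
    then show ?thesis
      using C miss_cost_nonneg[of 0 L] by (auto simp: excess_def miss_cost_def)
  qed
  then have "expect ?P (\<lambda>_. 0) \<le> expect ?P (excess k 0)"
    using B by (intro expect_mono finite_play) auto
  then show "0 \<le> expect (return_pmf [0]) (\<lambda>b.
      expect (play B os Cs (obs_from s b (first_from (s + 1) (closing 0) f))) (excess k 0))"
    by simp
qed

primrec body_length :: "nat \<Rightarrow> nat \<Rightarrow> nat" where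
  "body_length J 0 = 1"
| "body_length J (Suc m) = (J + 2) * (body_length J m + m + 2)"

primrec body :: "nat \<Rightarrow> nat \<Rightarrow> page list pmf" where
  "body J 0 = return_pmf [0]"
| "body J (Suc m) = map_pmf (assemble m (body_length J m) (body_length J (Suc m)))
     (rounds (body J m) (stops J))"

lemma regular_body: "regular m (body_length J m) (body J m)"
  by (induction m) (auto simp: regular_level_0[simplified] stops_def intro!: regular_assemble)

lemma hard_body: "serving k B \<Longrightarrow> Suc m \<le> k \<Longrightarrow> hard k B m (body_length J m) (body J m)"
proof (induction m)
  case 0
  then show ?case using hard_level_0 by simp
next
  case (Suc m)
  then show ?case
    unfolding body.simps by (intro hard_assemble regular_body) auto
qed

subsection \<open>The offline cost of a phase\<close>

text \<open>The cost is only bounded by \<open>c\<close>, so upper estimates compose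
  directly.\<close>

definition walk :: "nat \<Rightarrow> cache \<Rightarrow> page list \<Rightarrow> cache \<Rightarrow> real \<Rightarrow> bool" where
  "walk k C \<sigma> D c \<longleftrightarrow> (\<exists>Cs. list_all2 (serves {..k} k) \<sigma> Cs \<and> last (C # Cs) = D \<and>
     cost_from (\<lambda>p. 2 ^ p) C Cs \<le> c)"

abbreviation without :: "nat \<Rightarrow> page \<Rightarrow> cache" where
  "without k p \<equiv> {..k} - {p}"

text \<open>
  Offline costs are measured between caches that miss page \<open>1\<close>, so that they add up over phases.
\<close>

definition offline :: "nat \<Rightarrow> page list \<Rightarrow> real" where
  "offline k \<sigma> = Inf {c. walk k (without k 1) \<sigma> (without k 1) c}"

lemma cost_from_nonneg: "(\<And>p. 0 \<le> w p) \<Longrightarrow> 0 \<le> cost_from w C Cs"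
  by (induction Cs arbitrary: C) (auto intro!: add_nonneg_nonneg sum_nonneg)

lemma cost_from_append: "cost_from w C (Cs @ Ds) = cost_from w C Cs + cost_from w (last (C # Cs)) Ds"
  by (induction Cs arbitrary: C) auto

lemma walk_append:
  assumes "walk k C \<sigma> D c" "walk k D \<tau> E d"
  shows "walk k C (\<sigma> @ \<tau>) E (c + d)"
proof -
  obtain Cs Ds where "list_all2 (serves {..k} k) \<sigma> Cs" "last (C # Cs) = D"
    "cost_from (\<lambda>p. 2 ^ p) C Cs \<le> c" "list_all2 (serves {..k} k) \<tau> Ds" "last (D # Ds) = E"
    "cost_from (\<lambda>p. 2 ^ p) D Ds \<le> d"
    using assms unfolding walk_def by blast
  then show ?thesis
    unfolding walk_def
    by (intro exI[of _ "Cs @ Ds"]) (auto simp: cost_from_append intro!: list_all2_appendI split: if_splits)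
qed

lemma walk_stay:
  assumes "set \<sigma> \<subseteq> without k q" "q \<le> k"
  shows "walk k (without k q) \<sigma> (without k q) 0"
  unfolding walk_def
proof (intro exI conjI)
  let ?Cs = "replicate (length \<sigma>) (without k q)"
  show "list_all2 (serves {..k} k) \<sigma> ?Cs"
    using assms by (auto simp: list_all2_conv_all_nth serves_def dest!: nth_mem)
  show "last (without k q # ?Cs) = without k q" by simp
  have "cost_from w C (replicate n C) = 0" for w C n by (induction n) auto
  then show "cost_from (\<lambda>p. 2 ^ p) (without k q) ?Cs \<le> 0" by simp
qed

text \<open>The hole moves from \<open>h\<close> to \<open>q\<close> at the first request, which
  loads at most page \<open>h\<close>.\<close>

lemma walk_switch:
  assumes "set (r # \<sigma>) \<subseteq> without k q" "q \<le> k"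
  shows "walk k (without k h) (r # \<sigma>) (without k q) (2 ^ h)"
proof -
  have "(\<Sum>p\<in>without k q - without k h. 2 ^ p) \<le> (\<Sum>p\<in>{h}. 2 ^ p :: real)"
    by (intro sum_mono2) auto
  then have "walk k (without k h) [r] (without k q) (2 ^ h)"
    using assms unfolding walk_def by (intro exI[of _ "[without k q]"]) (auto simp: serves_def)
  from walk_append[OF this walk_stay[of \<sigma> k q]] show ?thesis using assms by simp
qed

lemma bdd_offline: "bdd_below {c. walk k C \<sigma> D c}"
proof (rule bdd_belowI)
  fix c assume "c \<in> {c. walk k C \<sigma> D c}"
  then obtain Cs where "cost_from (\<lambda>p. 2 ^ p) C Cs \<le> c"
    unfolding walk_def by blast
  with cost_from_nonneg[of "\<lambda>p. 2 ^ p" C Cs] show "0 \<le> c" by simp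
qed

lemma offline_le: "walk k (without k 1) \<sigma> (without k 1) c \<Longrightarrow> offline k \<sigma> \<le> c"
  unfolding offline_def using bdd_offline by (intro cInf_lower) auto

lemma le_offline:
  assumes "walk k (without k 1) \<sigma> (without k 1) c0"
    "\<And>c. walk k (without k 1) \<sigma> (without k 1) c \<Longrightarrow> x \<le> c"
  shows "x \<le> offline k \<sigma>"
  unfolding offline_def using assms by (intro cInf_greatest) auto

text \<open>The two infima are taken one after the other; the given walks show that both sets are
  nonempty.\<close>

lemma offline_append:
  assumes "walk k (without k 1) \<sigma> (without k 1) c" "walk k (without k 1) \<tau> (without k 1) d"
  shows "offline k (\<sigma> @ \<tau>) \<le> offline k \<sigma> + offline k \<tau>"
proof -
  have "offline k (\<sigma> @ \<tau>) - d' \<le> offline k \<sigma>"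
    if "walk k (without k 1) \<tau> (without k 1) d'" for d'
    using assms(1) walk_append[OF _ that, THEN offline_le] by (intro le_offline) (auto simp: le_diff_eq diff_le_eq)
  then have "offline k (\<sigma> @ \<tau>) - offline k \<sigma> \<le> offline k \<tau>"
    using assms(2) by (intro le_offline) (auto simp: diff_le_eq algebra_simps)
  then show ?thesis by simp
qed

lemma closing_heavy: "closing m = Suc m # rev [1..<Suc m] @ [0]"
  by (simp add: closing_def upt_conv_Cons[of 0] del: upt_Suc) (simp add: upt_Suc_append)

lemma closing_light: "closing m = rev [2..<m + 2] @ [1, 0]"
  by (simp add: closing_def upt_conv_Cons numeral_2_eq_2 del: upt_Suc)

text \<open>The hole stays at page \<open>1\<close> until its request, moves to page
  \<open>0\<close> and returns at once, for \<open>2 + 1\<close>.\<close>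

lemma walk_closing_light:
  assumes "Suc m \<le> k"
  shows "walk k (without k 1) (closing m) (without k 1) 3"
proof -
  have "walk k (without k 1) (rev [2..<m + 2]) (without k 1) 0"
    using assms by (intro walk_stay) auto
  moreover have "walk k (without k 1) [1] (without k 0) (2 ^ 1)"
    using assms by (intro walk_switch) auto
  moreover have "walk k (without k 0) [0] (without k 1) (2 ^ 0)"
    using assms by (intro walk_switch) auto
  ultimately have "walk k (without k 1) (rev [2..<m + 2] @ [1] @ [0]) (without k 1) (0 + (2 ^ 1 + 2 ^ 0))"
    by (intro walk_append)
  then show ?thesis by (simp add: closing_light)
qed

text \<open>The hole hides at page \<open>m + 1\<close>, which \<open>b\<close> does not request;
  the loads are page \<open>1\<close>, page \<open>m + 1\<close> and page \<open>0\<close>.\<close>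

lemma walk_closing_heavy:
  assumes "Suc m \<le> k" "set b \<subseteq> {..m}" "b \<noteq> []"
  shows "walk k (without k 1) (b @ closing m) (without k 1) (2 ^ Suc m + 3)"
proof -
  obtain r b' where b: "b = r # b'" using assms(3) by (cases b) auto
  have "set b \<subseteq> without k (Suc m)" using assms by fastforce
  then have "walk k (without k 1) b (without k (Suc m)) (2 ^ 1)"
    unfolding b using assms(1) by (rule walk_switch)
  moreover have "walk k (without k (Suc m)) (Suc m # rev [1..<Suc m]) (without k 0) (2 ^ Suc m)"
    using assms by (intro walk_switch) auto
  moreover have "walk k (without k 0) [0] (without k 1) (2 ^ 0)"
    using assms by (intro walk_switch) auto
  ultimately have "walk k (without k 1) (b @ (Suc m # rev [1..<Suc m]) @ [0]) (without k 1)
      (2 ^ 1 + (2 ^ Suc m + 2 ^ 0))"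
    by (intro walk_append)
  then show ?thesis by (simp add: closing_heavy add.commute)
qed

lemma offline_assemble:
  assumes "1 \<le> k" "\<And>b. b \<in> set bs \<Longrightarrow> \<exists>c. walk k (without k 1) (b @ closing m) (without k 1) c"
  shows "offline k (assemble m l N bs) \<le> (\<Sum>b\<leftarrow>bs. offline k (b @ closing m))"
    and "\<exists>c. walk k (without k 1) (assemble m l N bs) (without k 1) c"
proof -
  have "offline k (assemble m l N bs) \<le> (\<Sum>b\<leftarrow>bs. offline k (b @ closing m)) \<and>
      (\<exists>c. walk k (without k 1) (assemble m l N bs) (without k 1) c)"
    using assms(2)
  proof (induction bs arbitrary: N)
    case Nil
    have "walk k (without k 1) (assemble m l N []) (without k 1) 0"
      using assms(1) by (auto simp: assemble_def intro!: walk_stay)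
    then show ?case using offline_le by auto
  next
    case (Cons b bs)
    let ?R = "assemble m l (N - (l + m + 2)) bs"
    obtain c where c: "walk k (without k 1) (b @ closing m) (without k 1) c"
      using Cons.prems by auto
    obtain d where d: "walk k (without k 1) ?R (without k 1) d"
      and R: "offline k ?R \<le> (\<Sum>b\<leftarrow>bs. offline k (b @ closing m))"
      using Cons by fastforce
    show ?case
      using offline_append[OF c d] R walk_append[OF c d] by (auto simp: assemble_Cons)
  qed
  then show "offline k (assemble m l N bs) \<le> (\<Sum>b\<leftarrow>bs. offline k (b @ closing m))"
    and "\<exists>c. walk k (without k 1) (assemble m l N bs) (without k 1) c" by auto
qed

text \<open>The factor of \<open>expect D g\<close> is the expected number of blocks restricted to
  the event of at most \<open>J\<close> blocks; \<open>1 / 2 ^ J\<close> is the probability of more.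
  The offset \<open>t\<close> collects blocks already drawn in the induction.\<close>

lemma expect_rounds_stops:
  assumes "finite (set_pmf D)"
  shows "expect (rounds D (stops J)) (\<lambda>bs. if length bs \<le> J then t + (\<Sum>b\<leftarrow>bs. g b) else W) =
    t * (1 - 1 / 2 ^ J) + expect D g * (2 - (real J + 2) / 2 ^ J) + W / 2 ^ J"
proof (induction J arbitrary: t)
  case 0
  have "expect (rounds D (stops 0)) (\<lambda>bs. if length bs \<le> 0 then t + (\<Sum>b\<leftarrow>bs. g b) else W) =
      expect (rounds D (stops 0)) (\<lambda>_. W)"
    by (intro expect_cong) (auto dest!: set_rounds simp: stops_def simp del: rounds.simps)
  then show ?case by simp
next
  case (Suc J)
  have "expect (rounds D (stops (Suc J)))
        (\<lambda>bs. if length bs \<le> Suc J then t + (\<Sum>b\<leftarrow>bs. g b) else W) =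
      expect D (\<lambda>b. 1 / 2 * (t + g b) + 1 / 2 * expect (rounds D (stops J))
        (\<lambda>bs. if length bs \<le> J then (t + g b) + (\<Sum>b\<leftarrow>bs. g b) else W))"
    using expect_rounds[OF assms, of "1 / 2" "stops J"
        "\<lambda>bs. if length bs \<le> Suc J then t + (\<Sum>b\<leftarrow>bs. g b) else W"]
    by (simp add: stops_def add.assoc cong: if_cong)
  also have "\<dots> = expect D (\<lambda>b. (t * (1 - 1 / 2 ^ Suc J) +
      expect D g * (1 - (real J + 2) / 2 ^ Suc J) + W / 2 ^ Suc J) + g b * (1 - 1 / 2 ^ Suc J))"
    unfolding Suc.IH by (intro expect_cong) (simp add: field_simps)
  also have "\<dots> = t * (1 - 1 / 2 ^ Suc J) +
      expect D g * (1 - (real J + 2) / 2 ^ Suc J) + W / 2 ^ Suc J + expect D g * (1 - 1 / 2 ^ Suc J)"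
    using assms by (simp add: expect_add)
  also have "\<dots> = t * (1 - 1 / 2 ^ Suc J) + expect D g * (2 - (real (Suc J) + 2) / 2 ^ Suc J) + W / 2 ^ Suc J"
    by (simp add: field_simps)
  finally show ?case .
qed

text \<open>Sharper than \<open>regular\<close>: page \<open>m + 1\<close> occurs only in the
  closing requests, which makes it a place for the hole.\<close>

lemma body_nonempty:
  assumes "b \<in> set_pmf (body J m)"
  shows "b \<noteq> []" "set b \<subseteq> {..m}"
proof -
  have "0 < body_length J m" by (cases m) auto
  then show "b \<noteq> []" using regularD(2)[OF regular_body assms] by auto
  show "set b \<subseteq> {..m}"
  proof (cases m)
    case (Suc n)
    with assms obtain bs where bs: "bs \<in> set_pmf (rounds (body J n) (stops J))"
      and b: "b = assemble n (body_length J n) (body_length J m) bs" by auto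
    then show ?thesis
      unfolding b Suc using set_rounds[OF bs] regularD(3)[OF regular_body] by (intro set_assemble) blast
  qed (use assms in simp)
qed

section \<open>Expected offline cost, level by level\<close>

definition offline_level :: "nat \<Rightarrow> nat \<Rightarrow> nat \<Rightarrow> real" where
  "offline_level k J m = expect (body J m) (\<lambda>b. offline k (b @ closing m))"

lemma finite_body: "finite (set_pmf (body J m))"
  using regularD(1)[OF regular_body] .

lemma offline_level_0: "1 \<le> k \<Longrightarrow> offline_level k J 0 \<le> 5"
  using offline_le[OF walk_closing_heavy[of 0 k "[0]"]] by (simp add: offline_level_def)

lemma walk_body:
  assumes "b \<in> set_pmf (body J m)" "Suc m \<le> k"
  shows "walk k (without k 1) (b @ closing m) (without k 1) (2 ^ Suc m + 3)"
  using walk_closing_heavy assms body_nonempty by blast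

text \<open>Knowing the number of blocks, the offline player serves up to \<open>J\<close> blocks
  one by one and pays \<open>3\<close> for the closing requests; for more blocks it parks the hole
  at page \<open>m + 2\<close>.\<close>

lemma offline_level_Suc:
  assumes "Suc (Suc m) \<le> k"
  shows "offline_level k J (Suc m) \<le>
    offline_level k J m * (2 - (real J + 2) / 2 ^ J) + 2 ^ Suc (Suc m) / 2 ^ J + 3"
proof -
  let ?g = "\<lambda>b. offline k (b @ closing m)" and ?W = "2 ^ Suc (Suc m) + 3 :: real"
  let ?a = "assemble m (body_length J m) (body_length J (Suc m))"
  have "offline_level k J (Suc m) =
      expect (rounds (body J m) (stops J)) (\<lambda>bs. offline k (?a bs @ closing (Suc m)))"
    by (simp add: offline_level_def)
  also have "\<dots> \<le> expect (rounds (body J m) (stops J))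
      (\<lambda>bs. if length bs \<le> J then 3 + (\<Sum>b\<leftarrow>bs. ?g b) else ?W)"
  proof (rule expect_mono)
    show "finite (set_pmf (rounds (body J m) (stops J)))" by (intro finite_rounds finite_body)
    fix bs assume bs: "bs \<in> set_pmf (rounds (body J m) (stops J))"
    have light: "walk k (without k 1) (closing (Suc m)) (without k 1) 3"
      using assms by (rule walk_closing_light)
    have "\<exists>c. walk k (without k 1) (b @ closing m) (without k 1) c" if "b \<in> set bs" for b
      using walk_body[of b J m k] set_rounds[OF bs] that assms by auto
    moreover have "1 \<le> k" using assms by simp
    ultimately have "offline k (?a bs @ closing (Suc m)) \<le> (\<Sum>b\<leftarrow>bs. ?g b) + 3"
      using offline_assemble[of k bs m] offline_append[OF _ light] offline_le[OF light]
      by (smt (verit))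
    moreover have "offline k (?a bs @ closing (Suc m)) \<le> ?W"
      using bs assms by (intro offline_le walk_body[where J = J]) auto
    ultimately show "offline k (?a bs @ closing (Suc m)) \<le>
        (if length bs \<le> J then 3 + (\<Sum>b\<leftarrow>bs. ?g b) else ?W)" by simp
  qed
  also have "\<dots> = 3 * (1 - 1 / 2 ^ J) + offline_level k J m * (2 - (real J + 2) / 2 ^ J) + ?W / 2 ^ J"
    unfolding offline_level_def by (rule expect_rounds_stops) (rule finite_body)
  finally show ?thesis by (simp add: add_divide_distrib right_diff_distrib)
qed

text \<open>The coefficient \<open>6\<close> makes level \<open>0\<close> fit, as
  \<open>12 - 6 \<ge> 5\<close>. The final \<open>- 6\<close> absorbs the additive \<open>3\<close>,
  since \<open>3 - 12 * \<gamma> \<le> - 6\<close> for \<open>\<gamma> \<ge> 3 / 4\<close>.\<close>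

lemma offline_level_le:
  fixes J :: nat
  defines "\<gamma> \<equiv> 1 - (real J + 2) / 2 ^ Suc J :: real"
  assumes \<gamma>: "3 / 4 \<le> \<gamma>" and "Suc m \<le> k"
  shows "offline_level k J m \<le> 2 ^ Suc m * (2 / (real J + 2) + 6 * \<gamma> ^ m) - 6"
  using assms(3)
proof (induction m)
  case 0
  have "2 ^ Suc 0 * (2 / (real J + 2) + 6 * \<gamma> ^ 0) - 6 = 2 * (2 / (real J + 2)) + 6" by simp
  moreover have "0 \<le> 2 / (real J + 2)" by simp
  ultimately show ?case using offline_level_0[of k J] 0 by linarith
next
  case (Suc m)
  have double: "2 - (real J + 2) / 2 ^ J = 2 * \<gamma>"
  proof -
    have "2 - x / y = 2 * (1 - x / (2 * y))" for x y :: real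
      by (cases "y = 0") (auto simp: field_simps)
    then show ?thesis unfolding \<gamma>_def power_Suc .
  qed
  have fixpoint: "\<gamma> * (2 / (real J + 2)) = 2 / (real J + 2) - 1 / 2 ^ J"
  proof -
    have *: "(1 - x / (2 * y)) * (2 / x) = 2 / x - 1 / y" if "x \<noteq> 0" "y \<noteq> 0" for x y :: real
      using that by (simp add: field_simps)
    show ?thesis unfolding \<gamma>_def power_Suc by (rule *) auto
  qed
  have "offline_level k J (Suc m) \<le> offline_level k J m * (2 * \<gamma>) + 2 ^ Suc (Suc m) / 2 ^ J + 3"
    using offline_level_Suc[OF Suc.prems, of J] by (simp only: double)
  also have "\<dots> \<le> (2 ^ Suc m * (2 / (real J + 2) + 6 * \<gamma> ^ m) - 6) * (2 * \<gamma>) + 2 ^ Suc (Suc m) / 2 ^ J + 3"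
    using Suc \<gamma> by (intro add_right_mono mult_right_mono) auto
  also have "\<dots> = 2 ^ Suc (Suc m) * (\<gamma> * (2 / (real J + 2)) + 1 / 2 ^ J + 6 * \<gamma> ^ Suc m) + 3 - 12 * \<gamma>"
    by (simp add: algebra_simps)
  also have "\<dots> \<le> 2 ^ Suc (Suc m) * (2 / (real J + 2) + 6 * \<gamma> ^ Suc m) - 6"
    unfolding fixpoint using \<gamma> by simp
  finally show ?case .
qed

text \<open>From \<open>4 ^ J \<le> k\<close> follows
  \<open>(k - 1) * (J + 2) / 2 ^ (J + 1) \<ge> J\<close>, so
  \<open>\<gamma> ^ (k - 1) \<le> exp (- J) \<le> 1 / J\<close>, and the bound becomes
  \<open>2 / J + 6 / J\<close>.\<close>

lemma offline_top_level_le: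
  assumes J: "4 \<le> J" "4 ^ J \<le> k"
  shows "offline_level k J (k - 1) \<le> 2 ^ k * (8 / J)"
proof -
  define \<gamma> :: real where "\<gamma> = 1 - (real J + 2) / 2 ^ Suc J"
  \<comment> \<open>The induction starts with \<open>24 \<le> 32\<close>; at \<open>J = 3\<close>
    the inequality fails.\<close>
  have "4 * (J + 2) \<le> 2 ^ Suc J" using J(1) by (induction J rule: dec_induct) auto
  then have "4 * (real J + 2) \<le> 2 ^ Suc J"
    by (metis (mono_tags) of_nat_add of_nat_le_iff of_nat_mult of_nat_numeral of_nat_power)
  then have \<gamma>: "3 / 4 \<le> \<gamma>" by (simp add: \<gamma>_def field_simps)
  have "1 \<le> k" using J(2) by (meson one_le_power order_trans one_le_numeral)
  have "(4::nat) ^ 1 \<le> 4 ^ J" using J(1) by (intro power_increasing) auto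
  then have "4 ^ J \<le> 2 * (k - 1)" using J(2) by simp
  then have "(4::real) ^ J \<le> 2 * real (k - 1)"
    by (metis of_nat_le_iff of_nat_mult of_nat_numeral of_nat_power)
  then have k: "(2::real) ^ J * 2 ^ J \<le> 2 * real (k - 1)"
    by (simp flip: power_mult_distrib)
  have two: "4 \<le> (2::real) ^ J"
    using power_increasing[of 2 J "2::real"] J(1) by simp
  have "real J \<le> 2 ^ J * (real J + 2) / 4"
    using mult_right_mono[OF two, of "real J + 2"] by (simp add: algebra_simps)
  also have "\<dots> \<le> real (k - 1) * ((real J + 2) / 2 ^ Suc J)"
    using mult_right_mono[OF k, of "real J + 2"] by (simp add: field_simps)
  finally have expo: "real J \<le> real (k - 1) * ((real J + 2) / 2 ^ Suc J)" .
  have "\<gamma> \<le> exp (- ((real J + 2) / 2 ^ Suc J))"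
    using exp_ge_add_one_self[of "- ((real J + 2) / 2 ^ Suc J)"] by (simp add: \<gamma>_def)
  then have "\<gamma> ^ (k - 1) \<le> exp (- ((real J + 2) / 2 ^ Suc J)) ^ (k - 1)"
    using \<gamma> by (intro power_mono) auto
  also have "\<dots> = exp (- (real (k - 1) * ((real J + 2) / 2 ^ Suc J)))"
    by (simp flip: exp_of_nat_mult)
  also have "\<dots> \<le> exp (- real J)" using expo by simp
  also have "\<dots> \<le> 1 / J"
  proof -
    have "real J \<le> exp (real J)" using exp_ge_add_one_self[of "real J"] by linarith
    then show ?thesis using J(1) by (simp add: exp_minus field_simps)
  qed
  finally have pow: "\<gamma> ^ (k - 1) \<le> 1 / J" .
  have "2 / (real J + 2) \<le> 2 / real J" using J(1) by (simp add: field_simps)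
  moreover have "8 / real J = 2 / J + 6 * (1 / J)" by simp
  ultimately have "2 / (real J + 2) + 6 * \<gamma> ^ (k - 1) \<le> 8 / J" using pow by linarith
  then have "2 ^ k * (2 / (real J + 2) + 6 * \<gamma> ^ (k - 1)) \<le> 2 ^ k * (8 / J)"
    by (intro mult_left_mono) auto
  then show ?thesis
    using offline_level_le[of J "k - 1" k] \<gamma> \<open>1 \<le> k\<close> by (simp add: \<gamma>_def)
qed

subsection \<open>The competitive ratio\<close>

lemma opt_nonneg: "0 \<le> opt U k (\<lambda>p. 2 ^ p) \<sigma>" if "\<exists>Cs. list_all2 (serves U k) \<sigma> Cs"
  unfolding opt_def using that by (intro cInf_greatest) (auto simp: cost_def cost_from_nonneg)

text \<open>\<open>opt\<close> starts from the empty cache; loading the first cache in full costs at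
  most all weights together.\<close>

lemma opt_le_walk:
  assumes "walk k C \<sigma> D c"
  shows "opt {..k} k (\<lambda>p. 2 ^ p) \<sigma> \<le> c + (\<Sum>p\<le>k. 2 ^ p)"
proof -
  let ?w = "\<lambda>p. 2 ^ p :: real"
  obtain Cs where Cs: "list_all2 (serves {..k} k) \<sigma> Cs" "cost_from ?w C Cs \<le> c"
    using assms unfolding walk_def by blast
  have "opt {..k} k ?w \<sigma> \<le> cost ?w Cs"
    unfolding opt_def using Cs(1)
    by (intro cInf_lower bdd_belowI[of _ 0]) (auto simp: cost_def cost_from_nonneg)
  also have "cost ?w Cs \<le> cost_from ?w C Cs + (\<Sum>p\<le>k. ?w p)"
  proof (cases Cs)
    case (Cons E Es)
    then have "E \<subseteq> {..k}" using Cs(1) by (auto simp: list_all2_Cons2 serves_def)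
    then have "(\<Sum>p\<in>E. ?w p) \<le> (\<Sum>p\<le>k. ?w p)" by (intro sum_mono2) auto
    moreover have "0 \<le> (\<Sum>p\<in>E - C. ?w p)" by (intro sum_nonneg) auto
    ultimately show ?thesis by (simp add: Cons cost_def)
  qed (simp add: cost_def sum_nonneg)
  finally show ?thesis using Cs(2) by simp
qed

lemma expect_rounds_zeros:
  assumes "finite (set_pmf D)"
  shows "expect (rounds D (replicate R 0)) (\<lambda>bs. \<Sum>b\<leftarrow>bs. g b) = R * expect D g"
proof (induction R)
  case (Suc R)
  then show ?case
    using assms expect_rounds[OF assms, of 0 "replicate R 0" "\<lambda>bs. \<Sum>b\<leftarrow>bs. g b"]
    by (simp add: expect_add finite_rounds algebra_simps)
qed simp

lemma expected_cost_ge: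
  assumes A: "serving k (A {..k} w)" and w: "w = (\<lambda>p. 2 ^ p)" and \<sigma>: "set \<sigma> \<subseteq> {..k}" and "k = Suc m"
  shows "expect (play (A {..k} w) [] [] (obs_from 0 \<sigma> (\<lambda>_. \<infinity>))) (miss_cost m) \<le>
    expected_cost A {..k} w \<sigma> + (\<Sum>p\<le>k. 2 ^ p)"
proof -
  let ?P = "play (A {..k} w) [] [] (obs_from 0 \<sigma> (\<lambda>_. \<infinity>))"
  have fin: "finite (set_pmf ?P)" using A \<sigma> by (intro finite_play) auto
  have "expect ?P (miss_cost m) \<le> expect ?P (\<lambda>L. cost w L + (\<Sum>p\<le>k. 2 ^ p))"
  proof (rule expect_mono[OF fin])
    fix L assume L: "L \<in> set_pmf ?P"
    have "list_all2 (serves {..k} k) \<sigma> L"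
      using play_serves[OF A L] \<sigma> by simp
    then have "\<Union>(set L) \<subseteq> {..k}"
      by (fastforce simp: list_all2_conv_all_nth in_set_conv_nth serves_def)
    then show "miss_cost m L \<le> cost w L + (\<Sum>p\<le>k. 2 ^ p)"
      using cost_from_ge_gaps[of L k w "{}"] by (simp add: miss_cost_def cost_def w \<open>k = Suc m\<close>)
  qed
  then show ?thesis
    unfolding expected_cost_def run_eq_play map_observe using fin by (simp add: expect_add)
qed

text \<open>The adversary plays \<open>R\<close> phases of level \<open>k - 1\<close> without
  stopping. On average each costs the algorithm at least \<open>2 ^ k\<close> and the optimum at
  most \<open>e\<close>, up to constants independent of \<open>R\<close>.\<close>

lemma competitive_ge:
  assumes A: "semi_online_alg k A" and comp: "competitive k A \<rho>" and J: "4 \<le> J" "4 ^ J \<le> k"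
  shows "J / 8 \<le> \<rho>"
proof -
  have "1 \<le> k" using J(2) by (meson one_le_power order_trans one_le_numeral)
  then obtain m where m: "k = Suc m" by (cases k) auto
  define w :: "page \<Rightarrow> real" where "w = (\<lambda>p. 2 ^ p)"
  define S :: real where "S = (\<Sum>p\<le>k. 2 ^ p)"
  define e where "e = offline_level k J m"
  \<comment> \<open>A nonnegative factor allows the optimum to be replaced by an upper bound even if
    \<rho> were negative.\<close>
  define q where "q = max 0 \<rho>"
  let ?D = "body J m"
  let ?a = "assemble m (body_length J m) 0"
  have inst: "weighted_instance {..k} w" by (simp add: weighted_instance_def w_def)
  have serving: "serving k (A {..k} w)"
    unfolding serving_def using A inst unfolding semi_online_alg_def by (meson atMost_iff)
  obtain a where a: "\<And>\<sigma>. \<sigma> \<in> lists {..k} \<Longrightarrow> expected_cost A {..k} w \<sigma> \<le> \<rho> * opt {..k} k w \<sigma> + a"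
    using comp inst unfolding competitive_def by blast
  have main: "real R * 2 ^ k \<le> q * (R * e + S) + a + S" for R
  proof -
    let ?Q = "rounds ?D (replicate R 0)"
    let ?P = "\<lambda>bs. play (A {..k} w) [] [] (obs_from 0 (?a bs) (\<lambda>_. \<infinity>))"
    have fin: "finite (set_pmf ?Q)" by (intro finite_rounds finite_body)
    have bound: "expect (?P bs) (potential k m (body_length J m) 0 0 (length bs)) + length bs * 2 ^ k \<le>
        q * (\<Sum>b\<leftarrow>bs. offline k (b @ closing m)) + (q * S + a + S)"
      if bs: "bs \<in> set_pmf ?Q" for bs
    proof -
      have "set (?a bs) \<subseteq> {..Suc m}"
        using set_rounds[OF bs] regularD(3)[OF regular_body] by (intro set_assemble) blast
      then have sub: "set (?a bs) \<subseteq> {..k}" by (simp add: m)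
      have finP: "finite (set_pmf (?P bs))" using serving sub by (intro finite_play) auto
      have len: "length b = body_length J m" if "b \<in> set bs" for b
        using set_rounds[OF bs] that regularD(2)[OF regular_body] by blast
      have "expect (?P bs) (potential k m (body_length J m) 0 0 (length bs)) + length bs * 2 ^ k =
          expect (?P bs) (\<lambda>L. potential k m (body_length J m) 0 0 (length bs) L + length bs * 2 ^ k)"
        using finP by (simp add: expect_add)
      also have "\<dots> \<le> expect (?P bs) (miss_cost m)"
      proof (rule expect_mono[OF finP])
        fix L assume "L \<in> set_pmf (?P bs)"
        then have "list_all2 (\<in>) (?a bs) L" by (rule play_mem[OF serving sub])
        from potential_le_miss_cost_top[OF this len m]
        show "potential k m (body_length J m) 0 0 (length bs) L + length bs * 2 ^ k \<le> miss_cost m L"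
          by (simp add: m)
      qed
      also have "\<dots> \<le> expected_cost A {..k} w (?a bs) + S"
        unfolding S_def using serving w_def sub m by (rule expected_cost_ge)
      also have "expected_cost A {..k} w (?a bs) \<le> \<rho> * opt {..k} k w (?a bs) + a"
        using sub by (intro a) auto
      also have "\<rho> * opt {..k} k w (?a bs) \<le> q * ((\<Sum>b\<leftarrow>bs. offline k (b @ closing m)) + S)"
      proof -
        have paths: "\<exists>c. walk k (without k 1) (b @ closing m) (without k 1) c" if "b \<in> set bs" for b
          using walk_body[of b J m k] set_rounds[OF bs] that m by auto
        obtain c where c: "walk k (without k 1) (?a bs) (without k 1) c"
          using offline_assemble(2)[OF \<open>1 \<le> k\<close> paths] by blast
        have "opt {..k} k w (?a bs) - S \<le> offline k (?a bs)"
          using opt_le_walk by (intro le_offline[OF c]) (auto simp: w_def S_def diff_le_eq)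
        also have "\<dots> \<le> (\<Sum>b\<leftarrow>bs. offline k (b @ closing m))"
          using \<open>1 \<le> k\<close> paths by (rule offline_assemble)
        finally have "opt {..k} k w (?a bs) \<le> (\<Sum>b\<leftarrow>bs. offline k (b @ closing m)) + S" by simp
        moreover have "0 \<le> opt {..k} k w (?a bs)"
          unfolding w_def using c by (intro opt_nonneg) (auto simp: walk_def)
        ultimately show ?thesis
          unfolding q_def by (intro mult_mono) auto
      qed
      finally show ?thesis by (simp add: algebra_simps)
    qed
    have "worth 0 0 (replicate R 0) \<le>
        expect ?Q (\<lambda>bs. expect (?P bs) (potential k m (body_length J m) 0 0 (length bs)))"
      using serving _ regular_body hard_body[OF serving]
      by (rule worth_le_potential) (auto simp: m)
    then have nonneg:
      "0 \<le> expect ?Q (\<lambda>bs. expect (?P bs) (potential k m (body_length J m) 0 0 (length bs)))"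
      by (simp only: worth_zeros)
    have "real R * 2 ^ k = expect ?Q (\<lambda>bs. \<Sum>b\<leftarrow>bs. 2 ^ k)"
      using expect_rounds_zeros[OF finite_body, of J m R "\<lambda>_. 2 ^ k"] by simp
    also have "\<dots> = expect ?Q (\<lambda>bs. length bs * 2 ^ k)"
      by (simp add: sum_list_triv)
    also have "\<dots> \<le> expect ?Q (\<lambda>bs. expect (?P bs) (potential k m (body_length J m) 0 0 (length bs)))
        + expect ?Q (\<lambda>bs. length bs * 2 ^ k)"
      using nonneg by simp
    also have "\<dots> = expect ?Q (\<lambda>bs. expect (?P bs) (potential k m (body_length J m) 0 0 (length bs))
        + length bs * 2 ^ k)"
      using fin by (simp add: expect_add)
    also have "\<dots> \<le> expect ?Q (\<lambda>bs. q * (\<Sum>b\<leftarrow>bs. offline k (b @ closing m)) + (q * S + a + S))"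
      using fin bound by (rule expect_mono)
    also have "\<dots> = q * (R * e) + (q * S + a + S)"
      using fin expect_rounds_zeros[OF finite_body, of J m R "\<lambda>b. offline k (b @ closing m)"]
      by (simp add: expect_add e_def offline_level_def)
    finally show ?thesis by (simp add: algebra_simps)
  qed
  \<comment> \<open>Large \<open>R\<close> outweighs the additive constants.\<close>
  have "2 ^ k \<le> q * e"
  proof (rule ccontr)
    assume "\<not> 2 ^ k \<le> q * e"
    then obtain R where "q * S + a + S < real R * (2 ^ k - q * e)"
      using reals_Archimedean3[of "2 ^ k - q * e"] by auto
    with main[of R] show False by (simp add: algebra_simps)
  qed
  also have "\<dots> \<le> q * (2 ^ k * (8 / J))"
    using offline_top_level_le[OF J] by (intro mult_left_mono) (auto simp: e_def m q_def)
  finally have "2 ^ k * 1 \<le> 2 ^ k * (q * (8 / J))" by (simp add: mult_ac)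
  then have "1 \<le> q * (8 / J)" by (subst (asm) mult_le_cancel_left_pos) auto
  then have "J / 8 \<le> q" using J(1) by (simp add: field_simps)
  moreover have "0 < real J / 8" using J(1) by simp
  ultimately show ?thesis unfolding q_def by linarith
qed

theorem theorem5:
  "\<exists>c>0. \<forall>\<^sub>F k in sequentially. \<forall>A. semi_online_alg k A \<longrightarrow>
     ereal (c * ln (real k)) \<le> competitive_ratio k A"
\<comment> \<open>\<open>256 = 4 ^ 4\<close> ensures \<open>J \<ge> 4\<close>. The bound
  \<open>ln 4 \<le> 2\<close> and rounding down to \<open>J\<close> lose a factor \<open>2\<close>
  each, and \<open>competitive_ge\<close> loses \<open>8\<close>.\<close>
proof (intro exI[of _ "1 / 32"] conjI eventually_sequentiallyI[of 256] allI impI)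
  fix k A assume k: "256 \<le> k" and A: "semi_online_alg k A"
  define J where "J = nat \<lfloor>log 4 k\<rfloor>"
  have "log 4 256 = (4::real)" using log_pow_cancel[of 4 4] by simp
  then have log4: "4 \<le> log 4 k" using k log_le_cancel_iff[of 4 256 "real k"] by simp
  then have "4 \<le> J" by (simp add: J_def le_nat_iff le_floor_iff)
  have "real J \<le> log 4 k" using log4 by (simp add: J_def)
  then have "4 powr J \<le> 4 powr log 4 k" by (intro powr_mono) auto
  then have "(4::real) ^ J \<le> k" using k by (simp add: powr_realpow)
  then have "4 ^ J \<le> k" by (metis of_nat_le_iff of_nat_numeral of_nat_power)
  have "ln (4::real) = 2 * ln 2" using ln_realpow[of 2 2] by simp
  also have "\<dots> \<le> 2" using ln_le_minus_one[of 2] by simp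
  finally have "ln (real k) / 2 \<le> log 4 k"
    unfolding log_def using k by (intro divide_left_mono) auto
  moreover have "log 4 k - 1 \<le> J" using log4 by (simp add: J_def)
  ultimately have "ln (real k) / 4 \<le> J" using log4 by linarith
  then have "1 / 32 * ln (real k) \<le> J / 8" by simp
  then show "ereal (1 / 32 * ln (real k)) \<le> competitive_ratio k A"
    unfolding competitive_ratio_def
    using competitive_ge[OF A _ \<open>4 \<le> J\<close> \<open>4 ^ J \<le> k\<close>] by (intro INF_greatest) fastforce
qed simp

end
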